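(* Let $G$ be a finitely generated group with slow entropy growth. That is, suppose there is a non-degenerate finitely-supported symmetric probability measure $\mu$ on $G$ with $\mu(e)>0$ such that $$\liminf_{n\to\infty} n\bigl(H(\mu^{*(n+1)})-H(\mu^{*n})\bigr)<\infty .$$ Then $G$ has Shalom's property $H_{\mathrm{FD}}$: for every unitary representation $\pi$ of $G$ on a Hilbert space, if $\overline{H^1}(G,\pi)\neq 0$, then $\pi$ is not weakly mixing.
   Context: $G$ is a discrete group with identity $e$. A probability measure $\mu$ on $G$ is symmetric if $\mu(x^{-1})=\mu(x)$ for all $x\in G$, and non-degenerate if its support generates $G$. Convolution is $(\mu*\nu)(x)=\sum_{g\in G}\mu(g)\nu(g^{-1}x)$, and $\mu^{*n}$ is the $n$-fold convolution power. The entropy of a finitely supported probability measure $p$ is $H(p)=-\sum_x p(x)\log p(x)$, with $0\log 0=0$. Let $\pi$ be a unitary representation of $G$ on a (complex) Hilbert space $\mathcal{H}$. A $1$-cocycle with coefficients in $\pi$ is a map $b\colon G\to\mathcal{H}$ with $b(gx)=b(g)+\pi_g b(x)$ for all $g,x\in G$. A $1$-coboundary is a $1$-cocycle of the form $b(g)=\xi-\pi_g\xi$ for some $\xi\in\mathcal{H}$. An approximate $1$-coboundary is a $1$-cocycle that is a pointwise limit of $1$-coboundaries. Denote by $Z^1(G,\pi)$ the space of $1$-cocycles and by $\overline{B^1(G,\pi)}$ the space of approximate $1$-coboundaries; the reduced cohomology is $\overline{H^1}(G,\pi)=Z^1(G,\pi)/\overline{B^1(G,\pi)}$. The representation $\pi$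 is weakly mixing if $\mathcal{H}$ admits no nonzero finite-dimensional $\pi(G)$-invariant subspace. *)

theory Defs
  imports "HOL-Probability.Probability" "HOL-Algebra.Generated_Groups" "HOL-Algebra.Elementary_Groups"
begin

section \<open>Complex Hilbert spaces\<close>

class chilbert_space = banach +
  fixes scaleC :: "complex \<Rightarrow> 'a \<Rightarrow> 'a"  (infixr "*\<^sub>C" 75)
    and cinner :: "'a \<Rightarrow> 'a \<Rightarrow> complex"
  assumes scaleC_add_right: "a *\<^sub>C (x + y) = a *\<^sub>C x + a *\<^sub>C y"
    and scaleC_add_left: "(a + b) *\<^sub>C x = a *\<^sub>C x + b *\<^sub>C x"
    and scaleC_scaleC: "a *\<^sub>C (b *\<^sub>C x) = (a * b) *\<^sub>C x"
    and scaleC_one: "1 *\<^sub>C x = x"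
    and scaleR_scaleC: "r *\<^sub>R x = complex_of_real r *\<^sub>C x"
    and cinner_commute: "cinner x y = cnj (cinner y x)"
    and cinner_add_left: "cinner (x + y) z = cinner x z + cinner y z"
    and cinner_scaleC_left: "cinner (a *\<^sub>C x) y = a * cinner x y"
    and norm_eq_sqrt_cinner: "norm x = sqrt (Re (cinner x x))"

global_interpretation complex_vector:
  vector_space "scaleC :: complex \<Rightarrow> 'a \<Rightarrow> 'a :: chilbert_space"
  defines csubspace = complex_vector.subspace
    and cspan = complex_vector.span
  by unfold_locales (simp_all add: scaleC_add_right scaleC_add_left scaleC_scaleC scaleC_one)

instantiation complex :: chilbert_space
begin

definition scaleC_complex :: "complex \<Rightarrow> complex \<Rightarrow> complex" where
  "scaleC_complex a x = a * x"

definition cinner_complex :: "complex \<Rightarrow> complex \<Rightarrow> complex" where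
  "cinner_complex x y = x * cnj y"

instance
proof
  fix a b x y z :: complex and r :: real
  show "a *\<^sub>C (x + y) = a *\<^sub>C x + a *\<^sub>C y" "(a + b) *\<^sub>C x = a *\<^sub>C x + b *\<^sub>C x"
    "a *\<^sub>C (b *\<^sub>C x) = (a * b) *\<^sub>C x" "1 *\<^sub>C x = x"
    by (simp_all add: scaleC_complex_def distrib_left distrib_right)
  show "r *\<^sub>R x = complex_of_real r *\<^sub>C x"
    by (simp add: scaleC_complex_def scaleR_conv_of_real)
  show "cinner x y = cnj (cinner y x)" "cinner (x + y) z = cinner x z + cinner y z"
    "cinner (a *\<^sub>C x) y = a * cinner x y"
    by (simp_all add: cinner_complex_def scaleC_complex_def distrib_right)
  show "norm x = sqrt (Re (cinner x x))"
    by (simp add: cinner_complex_def cmod_def power2_eq_square)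
qed

end


section \<open>Entropy of random walks\<close>

definition convolution ::
  "('g, 'm) monoid_scheme \<Rightarrow> ('g \<Rightarrow> real) \<Rightarrow> ('g \<Rightarrow> real) \<Rightarrow> 'g \<Rightarrow> real" where
  "convolution G p q x = (\<Sum>\<^sub>\<infinity>g\<in>carrier G. p g * q (inv\<^bsub>G\<^esub> g \<otimes>\<^bsub>G\<^esub> x))"

fun conv_power ::
  "('g, 'm) monoid_scheme \<Rightarrow> ('g \<Rightarrow> real) \<Rightarrow> nat \<Rightarrow> 'g \<Rightarrow> real" where
  "conv_power G p 0 = (\<lambda>x. if x = \<one>\<^bsub>G\<^esub> then 1 else 0)"
| "conv_power G p (Suc n) = convolution G p (conv_power G p n)"

text \<open>The convention \<open>0 log 0 = 0\<close> holds automatically, since the factor \<open>p x\<close> vanishes.\<close>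

definition shannon_entropy :: "('g, 'm) monoid_scheme \<Rightarrow> ('g \<Rightarrow> real) \<Rightarrow> real" where
  "shannon_entropy G p = - (\<Sum>\<^sub>\<infinity>x\<in>carrier G. p x * ln (p x))"

definition symmetric_measure :: "('g, 'm) monoid_scheme \<Rightarrow> 'g pmf \<Rightarrow> bool" where
  "symmetric_measure G \<mu> \<longleftrightarrow> (\<forall>x\<in>carrier G. pmf \<mu> (inv\<^bsub>G\<^esub> x) = pmf \<mu> x)"

definition nondegenerate_measure :: "('g, 'm) monoid_scheme \<Rightarrow> 'g pmf \<Rightarrow> bool" where
  "nondegenerate_measure G \<mu> \<longleftrightarrow> generate G (set_pmf \<mu>) = carrier G"

definition finitely_generated :: "('g, 'm) monoid_scheme \<Rightarrow> bool" where
  "finitely_generated G \<longleftrightarrow> (\<exists>S. finite S \<and> S \<subseteq> carrier G \<and> generate G S = carrier G)"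

definition slow_entropy_growth :: "('g, 'm) monoid_scheme \<Rightarrow> bool" where
  "slow_entropy_growth G \<longleftrightarrow>
    (\<exists>\<mu> :: 'g pmf. set_pmf \<mu> \<subseteq> carrier G \<and> finite (set_pmf \<mu>) \<and>
       symmetric_measure G \<mu> \<and> nondegenerate_measure G \<mu> \<and> pmf \<mu> \<one>\<^bsub>G\<^esub> > 0 \<and>
       liminf (\<lambda>n. ereal (real n * (shannon_entropy G (conv_power G (pmf \<mu>) (n + 1))
                                    - shannon_entropy G (conv_power G (pmf \<mu>) n)))) < \<infinity>)"


section \<open>Unitary representations and reduced cohomology\<close>

definition unitary :: "('h :: chilbert_space \<Rightarrow> 'h) \<Rightarrow> bool" where
  "unitary U \<longleftrightarrow> Vector_Spaces.linear scaleC scaleC U \<and> surj U \<and>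
     (\<forall>x y. cinner (U x) (U y) = cinner x y)"

definition unitary_rep ::
  "('g, 'm) monoid_scheme \<Rightarrow> ('g \<Rightarrow> 'h \<Rightarrow> 'h :: chilbert_space) \<Rightarrow> bool" where
  "unitary_rep G \<pi> \<longleftrightarrow> (\<forall>g\<in>carrier G. unitary (\<pi> g)) \<and>
     (\<forall>g\<in>carrier G. \<forall>h\<in>carrier G. \<pi> (g \<otimes>\<^bsub>G\<^esub> h) = \<pi> g \<circ> \<pi> h)"

text \<open>Maps \<open>G \<rightarrow> \<H>\<close> are represented by functions that are \<open>undefined\<close> off
  \<open>carrier G\<close>, so that equality of cocycles is equality on the group.\<close>

definition cocycles ::
  "('g, 'm) monoid_scheme \<Rightarrow> ('g \<Rightarrow> 'h \<Rightarrow> 'h :: chilbert_space) \<Rightarrow> ('g \<Rightarrow> 'h) set" where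
  "cocycles G \<pi> = {b \<in> extensional (carrier G).
     \<forall>g\<in>carrier G. \<forall>x\<in>carrier G. b (g \<otimes>\<^bsub>G\<^esub> x) = b g + \<pi> g (b x)}"

definition coboundaries ::
  "('g, 'm) monoid_scheme \<Rightarrow> ('g \<Rightarrow> 'h \<Rightarrow> 'h :: chilbert_space) \<Rightarrow> ('g \<Rightarrow> 'h) set" where
  "coboundaries G \<pi> = {b \<in> cocycles G \<pi>. \<exists>\<xi>. \<forall>g\<in>carrier G. b g = \<xi> - \<pi> g \<xi>}"

text \<open>The product topology on \<open>\<H>\<^sup>G\<close> is the topology of pointwise norm convergence.\<close>

definition approx_coboundaries ::
  "('g, 'm) monoid_scheme \<Rightarrow> ('g \<Rightarrow> 'h \<Rightarrow> 'h :: chilbert_space) \<Rightarrow> ('g \<Rightarrow> 'h) set" where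
  "approx_coboundaries G \<pi> =
     cocycles G \<pi> \<inter> (product_topology (\<lambda>_. euclidean) (carrier G) closure_of coboundaries G \<pi>)"

definition cocycle_group ::
  "('g, 'm) monoid_scheme \<Rightarrow> ('g \<Rightarrow> 'h \<Rightarrow> 'h :: chilbert_space) \<Rightarrow> ('g \<Rightarrow> 'h) monoid" where
  "cocycle_group G \<pi> = \<lparr>carrier = cocycles G \<pi>,
     mult = (\<lambda>b c. \<lambda>g\<in>carrier G. b g + c g), one = (\<lambda>g\<in>carrier G. 0)\<rparr>"

definition reduced_cohomology ::
  "('g, 'm) monoid_scheme \<Rightarrow> ('g \<Rightarrow> 'h \<Rightarrow> 'h :: chilbert_space) \<Rightarrow> ('g \<Rightarrow> 'h) set monoid" where
  "reduced_cohomology G \<pi> = cocycle_group G \<pi> Mod approx_coboundaries G \<pi>"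

definition weakly_mixing ::
  "('g, 'm) monoid_scheme \<Rightarrow> ('g \<Rightarrow> 'h \<Rightarrow> 'h :: chilbert_space) \<Rightarrow> bool" where
  "weakly_mixing G \<pi> \<longleftrightarrow>
     \<not> (\<exists>V. csubspace V \<and> V \<noteq> {0} \<and> (\<exists>B. finite B \<and> V = cspan B) \<and>
          (\<forall>g\<in>carrier G. \<pi> g ` V \<subseteq> V))"

text \<open>Quantification over all Hilbert spaces is quantification over the type \<open>'h\<close>, which a
  predicate on \<open>G\<close> alone cannot contain; hence the type argument.\<close>

definition property_HFD ::
  "'h :: chilbert_space itself \<Rightarrow> ('g, 'm) monoid_scheme \<Rightarrow> bool" where
  "property_HFD TYPE('h) G \<longleftrightarrow>
     (\<forall>\<pi> :: 'g \<Rightarrow> 'h \<Rightarrow> 'h. unitary_rep G \<pi> \<longrightarrow>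
        carrier (reduced_cohomology G \<pi>) \<noteq> {\<one>\<^bsub>reduced_cohomology G \<pi>\<^esub>} \<longrightarrow>
        \<not> weakly_mixing G \<pi>)"

end

(*
  Suppose the reduced cohomology is nonzero and pi is weakly mixing. Minimising the energy
  sum_s mu(s) |c(s) - (xi - pi_s xi)|^2 over xi produces a nonzero mu-harmonic cocycle b.

  Entropy: H(mu^(n+1)) - H(mu^n) is the mu-average over s of the relative entropy of the law of
  s X_n with respect to the law of X_(n+1). Since x |-> <b(x), v> is harmonic, comparing its
  expectations under these two laws gives
    mu(s)^2 |<b(s), v>|^2 <= 4 (H(mu^(n+1)) - H(mu^n)) E|<b(X_(n+1)), v>|^2.

  Mixing: E|<b(X_n), v>|^2 is a sum over k < n of averages of E|<pi_(X_k) b(s), v>|^2, so it is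
  o(n) once each of these tends to 0; together with slow entropy growth this forces b = 0.
  To see that they tend to 0, let A_k be the average of the rank one operators given by pi_(X_k) w.
  The Hilbert-Schmidt inner product of A_j and A_l depends only on j + l, and its value at 2k is
  convex and bounded in k, hence convergent. If the limit is nonzero, then A_(2j) converges in
  Hilbert-Schmidt norm to a nonzero self-adjoint operator commuting with pi (here mu(e) > 0 is
  used), whose top eigenspace is a finite-dimensional invariant subspace.
*)
theory Submission
  imports Defs
begin

section \<open>Finite families of vectors in a Hilbert space\<close>

text \<open>The entropy estimate alone is not contradictory: for a harmonic cocycle E|b(X_n)|^2
  grows like n, and multiplied by an entropy increment of order 1/n it only yields a constant. The
  gain comes from the scalar coefficients <b(X_n), v>, whose second moment is o(n) under weak
  mixing; v = b(s) then kills b(s). As o(n) holds for all large n, a bound along infinitely many n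
  (a liminf) suffices. Even times are forced by the operators: a squared Hilbert-Schmidt norm is a
  correlation at an even index, and these are what convexity controls. Limits are therefore taken
  along A_(2j), all of whose inner products have even index. Commutation with a single s is read off
  from two extra steps s, e; the weight mu(s) mu(e) of this path must be positive. Relative entropy
  acts through the Hellinger distance, since the compared functions are unbounded and only their
  second moments are known. The energy infimum need not be attained by a vector xi; the minimiser
  lives among the cocycles.\<close>

lemma cinner_add_right: "cinner x (y + z) = cinner x y + cinner x z"
  by (metis cinner_add_left cinner_commute complex_cnj_add)

lemma cinner_scaleC_right: "cinner x (a *\<^sub>C y) = cnj a * cinner x y"
  by (metis cinner_commute cinner_scaleC_left complex_cnj_mult)

lemma cinner_scaleR_left: "cinner (r *\<^sub>R x) y = r *\<^sub>R cinner x y"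
  by (simp add: scaleR_scaleC[of r x] cinner_scaleC_left scaleR_conv_of_real)

lemma cinner_scaleR_right: "cinner x (r *\<^sub>R y) = r *\<^sub>R cinner x y"
  by (simp add: scaleR_scaleC[of r y] cinner_scaleC_right scaleR_conv_of_real)

lemma Im_cinner_self: "Im (cinner x x) = 0"
  using cinner_commute[of x x] by (simp add: complex_eq_iff)

lemma Re_cinner_self: "Re (cinner x x) = (norm x)\<^sup>2"
proof -
  have "Re (cinner x x) \<ge> 0"
    using norm_ge_zero[of x] unfolding norm_eq_sqrt_cinner by simp
  then show ?thesis
    by (simp add: norm_eq_sqrt_cinner)
qed

lemma cinner_self: "cinner x x = of_real ((norm x)\<^sup>2)"
  by (simp add: complex_eq_iff Im_cinner_self Re_cinner_self)

lemma cinner_zero_left [simp]: "cinner 0 x = 0"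
  using cinner_add_left[of 0 0 x] by simp

lemma cinner_zero_right [simp]: "cinner x 0 = 0"
  using cinner_add_right[of x 0 0] by simp

lemma cinner_minus_left: "cinner (- x) y = - cinner x y"
  using cinner_add_left[of x "- x" y] by (simp add: eq_neg_iff_add_eq_0 add.commute)

lemma cinner_minus_right: "cinner x (- y) = - cinner x y"
  by (metis cinner_commute cinner_minus_left complex_cnj_minus)

lemma cinner_diff_left: "cinner (x - y) z = cinner x z - cinner y z"
  using cinner_add_left[of x "- y" z] by (simp add: cinner_minus_left)

lemma cinner_diff_right: "cinner x (y - z) = cinner x y - cinner x z"
  using cinner_add_right[of x y "- z"] by (simp add: cinner_minus_right)

lemma norm_add_squared: "(norm (x + y))\<^sup>2 = (norm x)\<^sup>2 + (norm y)\<^sup>2 + 2 * Re (cinner x y)"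
proof -
  have "Re (cinner y x) = Re (cinner x y)"
    by (subst cinner_commute) simp
  then show ?thesis
    by (simp add: Re_cinner_self[symmetric] cinner_add_left cinner_add_right)
qed

lemma norm_diff_squared: "(norm (x - y))\<^sup>2 = (norm x)\<^sup>2 + (norm y)\<^sup>2 - 2 * Re (cinner x y)"
  using norm_add_squared[of x "- y"] by (simp add: cinner_minus_right)

lemma norm_scaleC: "norm (a *\<^sub>C x) = cmod a * norm x"
proof -
  have "(norm (a *\<^sub>C x))\<^sup>2 = (cmod a * norm x)\<^sup>2"
    by (simp add: Re_cinner_self[symmetric, where x = x] Re_cinner_self[symmetric, where x = "a *\<^sub>C x"]
        cinner_scaleC_left cinner_scaleC_right power_mult_distrib cmod_power2 Im_cinner_self)
      (simp add: power2_eq_square algebra_simps)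
  then show ?thesis by simp
qed

lemma cinner_mult_commute: "cinner x y * cinner y x = of_real ((cmod (cinner x y))\<^sup>2)"
  by (subst (2) cinner_commute) (simp add: complex_mult_cnj cmod_power2)

lemma cmod_cinner_commute: "cmod (cinner x y) = cmod (cinner y x)"
  by (subst cinner_commute) simp

lemma cmod_cinner_le: "cmod (cinner x y) \<le> norm x * norm y"
proof (cases "y = 0")
  case False
  \<comment> \<open>\<open>t *\<^sub>C y\<close> is the orthogonal projection of \<open>x\<close>
    onto the line through \<open>y\<close>; the inequality is nonnegativity of |x - t y|^2.\<close>
  define t where "t = cinner x y / of_real ((norm y)\<^sup>2)"
  have n: "norm y > 0" using False by simp
  have ct: "cmod t * (norm y)\<^sup>2 = cmod (cinner x y)"
    using n by (simp add: t_def norm_divide norm_power)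
  have "cinner x (t *\<^sub>C y) = of_real ((cmod (cinner x y))\<^sup>2 / (norm y)\<^sup>2)"
    using n by (simp add: t_def cinner_scaleC_right cmod_power2 complex_mult_cnj mult.commute)
  then have r: "Re (cinner x (t *\<^sub>C y)) = (cmod (cinner x y))\<^sup>2 / (norm y)\<^sup>2"
    by simp
  have "cmod t = cmod (cinner x y) / (norm y)\<^sup>2"
    using n ct by (simp add: field_simps)
  then have "(norm (t *\<^sub>C y))\<^sup>2 = (cmod (cinner x y))\<^sup>2 / (norm y)\<^sup>2"
    using n by (simp add: norm_scaleC power_mult_distrib power_divide)
      (simp add: power2_eq_square power4_eq_xxxx)
  with r have "0 \<le> (norm x)\<^sup>2 - (cmod (cinner x y))\<^sup>2 / (norm y)\<^sup>2"
    using zero_le_power2[of "norm (x - t *\<^sub>C y)"] unfolding norm_diff_squared by linarith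
  then have "(cmod (cinner x y))\<^sup>2 \<le> (norm x * norm y)\<^sup>2"
    using n by (simp add: field_simps power_mult_distrib)
  then show ?thesis
    by (rule power2_le_imp_le) simp
qed simp

text \<open>A sesquilinear form is bilinear over the reals; this supplies the rules for sums, limits
  and continuity.\<close>

interpretation cinner: bounded_bilinear "cinner :: 'a::chilbert_space \<Rightarrow> 'a \<Rightarrow> complex"
proof
  show "\<exists>K. \<forall>a b :: 'a. norm (cinner a b) \<le> norm a * norm b * K"
    by (rule exI[of _ 1]) (simp add: cmod_cinner_le)
qed (simp_all add: cinner_add_left cinner_add_right cinner_scaleR_left cinner_scaleR_right)

interpretation scaleC: bounded_bilinear "scaleC :: complex \<Rightarrow> 'a::chilbert_space \<Rightarrow> 'a"
proof
  fix a :: complex and b :: 'a and r :: real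
  show "(r *\<^sub>R a) *\<^sub>C b = r *\<^sub>R (a *\<^sub>C b)" "a *\<^sub>C (r *\<^sub>R b) = r *\<^sub>R (a *\<^sub>C b)"
    by (simp_all add: scaleR_scaleC[where ?'a = 'a] scaleC_scaleC scaleR_conv_of_real mult.commute)
  show "\<exists>K. \<forall>(a :: complex) (b :: 'a). norm (a *\<^sub>C b) \<le> norm a * norm b * K"
    by (rule exI[of _ 1]) (simp add: norm_scaleC)
qed (simp_all add: scaleC_add_left scaleC_add_right)

section \<open>Orthonormal families and orthogonal projections\<close>

definition orthonormal :: "'a::chilbert_space set \<Rightarrow> bool" where
  "orthonormal E \<longleftrightarrow> (\<forall>e\<in>E. \<forall>f\<in>E. cinner e f = (if e = f then 1 else 0))"

lemma orthonormal_norm: "orthonormal E \<Longrightarrow> e \<in> E \<Longrightarrow> norm e = 1"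
  by (simp add: orthonormal_def norm_eq_sqrt_cinner)

definition orthoproj :: "'a::chilbert_space set \<Rightarrow> 'a \<Rightarrow> 'a" where
  "orthoproj E v = (\<Sum>e\<in>E. cinner v e *\<^sub>C e)"

lemma cinner_orthoproj:
  assumes "orthonormal E" "finite E" "f \<in> E"
  shows "cinner (orthoproj E v) f = cinner v f"
proof -
  have "cinner (orthoproj E v) f = (\<Sum>e\<in>E. if e = f then cinner v e else 0)"
    unfolding orthoproj_def cinner.sum_left
    by (rule sum.cong) (use assms in \<open>auto simp: cinner_scaleC_left orthonormal_def\<close>)
  then show ?thesis using assms by simp
qed

lemma cinner_orthoproj_self:
  "cinner v (orthoproj E v) = of_real (\<Sum>e\<in>E. (cmod (cinner v e))\<^sup>2)"
  by (simp add: orthoproj_def cinner.sum_right cinner_scaleC_right cmod_power2 complex_mult_cnj mult.commute)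

lemma norm_orthoproj:
  assumes "orthonormal E" "finite E"
  shows "(norm (orthoproj E v))\<^sup>2 = (\<Sum>e\<in>E. (cmod (cinner v e))\<^sup>2)"
proof -
  have "cinner (orthoproj E v) (orthoproj E v) = (\<Sum>e\<in>E. cnj (cinner v e) * cinner v e)"
    by (subst (2) orthoproj_def)
      (simp add: cinner.sum_right cinner_scaleC_right cinner_orthoproj assms)
  also have "\<dots> = of_real (\<Sum>e\<in>E. (cmod (cinner v e))\<^sup>2)"
    by (simp add: cmod_power2 complex_mult_cnj mult.commute)
  finally show ?thesis
    by (simp add: Re_cinner_self[symmetric])
qed

text \<open>This is 0 <= |v - Pv|^2 = |v|^2 - |Pv|^2 with P the projection onto the span of
  \<open>E\<close>.\<close>

lemma bessel:
  assumes "orthonormal E" "finite E"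
  shows "(\<Sum>e\<in>E. (cmod (cinner v e))\<^sup>2) \<le> (norm v)\<^sup>2"
  using zero_le_power2[of "norm (v - orthoproj E v)"]
  unfolding norm_diff_squared norm_orthoproj[OF assms] cinner_orthoproj_self by simp

text \<open>One Gram-Schmidt step. It serves twice: to build a family covering given vectors, and to
  enlarge a supposedly maximal family.\<close>

lemma orthonormal_insert:
  assumes "orthonormal E" "finite E" "v \<noteq> orthoproj E v"
  defines "d \<equiv> v - orthoproj E v"
  defines "e \<equiv> of_real (1 / norm d) *\<^sub>C d"
  shows "orthonormal (insert e E)" "e \<notin> E" "v = orthoproj E v + of_real (norm d) *\<^sub>C e"
proof -
  have d: "norm d > 0" using assms by simp
  have ne: "norm e = 1" unfolding e_def norm_scaleC using d by (simp add: norm_divide)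
  have o: "cinner e f = 0" "cinner f e = 0" if "f \<in> E" for f
  proof -
    show "cinner e f = 0"
      by (simp add: e_def d_def cinner_scaleC_left cinner_diff_left cinner_orthoproj that assms)
    then show "cinner f e = 0"
      by (subst cinner_commute) simp
  qed
  have ee: "cinner e e = 1" by (simp add: cinner_self ne)
  show "e \<notin> E" using o(1)[of e] ee by auto
  then show "orthonormal (insert e E)"
    using assms(1) o ee by (auto simp: orthonormal_def)
  have "of_real (norm d) *\<^sub>C e = d"
    using d by (simp add: e_def scaleC_scaleC scaleC_one)
  then show "v = orthoproj E v + of_real (norm d) *\<^sub>C e"
    by (simp add: d_def)
qed

lemma orthoproj_eqI:
  assumes "orthonormal E" "finite E" "u = (\<Sum>e\<in>E. c e *\<^sub>C e)"
  shows "orthoproj E u = u"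
proof -
  have "cinner u e = c e" if "e \<in> E" for e
  proof -
    have "cinner u e = (\<Sum>f\<in>E. if f = e then c f else 0)"
      unfolding assms(3) cinner.sum_left
      by (rule sum.cong) (use assms that in \<open>auto simp: cinner_scaleC_left orthonormal_def\<close>)
    then show ?thesis using assms that by simp
  qed
  then show ?thesis
    unfolding orthoproj_def by (subst assms(3)) (rule sum.cong, auto)
qed

text \<open>Induction by Gram-Schmidt. The condition \<open>orthoproj E u = u\<close> encodes
  membership of \<open>u\<close> in the span of \<open>E\<close> together with explicit
  coefficients.\<close>

lemma finite_orthonormal_cover:
  assumes "finite U"
  shows "\<exists>E. finite E \<and> orthonormal E \<and> (\<forall>u\<in>U. orthoproj E u = u)"
  using assms
proof (induction U)
  case empty
  then show ?case by (intro exI[of _ "{}"]) (simp add: orthonormal_def)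
next
  case (insert v U)
  then obtain E where E: "finite E" "orthonormal E" "\<forall>u\<in>U. orthoproj E u = u" by blast
  show ?case
  proof (cases "v = orthoproj E v")
    case True
    then show ?thesis using E by auto
  next
    case False
    define d where "d = v - orthoproj E v"
    define e where "e = of_real (1 / norm d) *\<^sub>C d"
    note i = orthonormal_insert[OF E(2,1) False, folded d_def, folded e_def]
    have "orthoproj (insert e E) u = u" if "u \<in> U" for u
    proof (rule orthoproj_eqI[OF i(1)])
      show "u = (\<Sum>f\<in>insert e E. (if f = e then 0 else cinner u f) *\<^sub>C f)"
      proof -
        have "u = (\<Sum>f\<in>E. cinner u f *\<^sub>C f)"
          using E(3) that by (simp add: orthoproj_def)
        also have "\<dots> = (\<Sum>f\<in>E. (if f = e then 0 else cinner u f) *\<^sub>C f)"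
          by (rule sum.cong) (use i(2) in auto)
        finally show ?thesis using E(1) i(2) by simp
      qed
    qed (use E in simp)
    moreover have "orthoproj (insert e E) v = v"
    proof (rule orthoproj_eqI[OF i(1)])
      have "(\<Sum>f\<in>E. cinner v f *\<^sub>C f) = (\<Sum>f\<in>E. (if f = e then of_real (norm d) else cinner v f) *\<^sub>C f)"
        by (rule sum.cong) (use i(2) in auto)
      then show "v = (\<Sum>f\<in>insert e E. (if f = e then of_real (norm d) else cinner v f) *\<^sub>C f)"
        using i(3) E(1) i(2) by (simp add: orthoproj_def add.commute)
    qed (use E in simp)
    ultimately show ?thesis
      using i(1) E(1) by (intro exI[of _ "insert e E"]) auto
  qed
qed

section \<open>Finite-rank operators and their Hilbert-Schmidt norms\<close>

definition rank_sum :: "('i \<Rightarrow> real) \<Rightarrow> ('i \<Rightarrow> 'a::chilbert_space) \<Rightarrow> 'i set \<Rightarrow> 'a \<Rightarrow> 'a" where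
  "rank_sum c u I v = (\<Sum>i\<in>I. c i *\<^sub>R (cinner v (u i) *\<^sub>C u i))"

text \<open>Trace of the product of two such operators: v |-> <v,u>u and v |-> <v,z>z have product
  of trace |<u,z>|^2. No basis enters, so later computations are finite sums over group
  elements.\<close>

definition gram_sum :: "('i \<Rightarrow> real) \<Rightarrow> ('i \<Rightarrow> 'a::chilbert_space) \<Rightarrow> 'i set \<Rightarrow>
    ('j \<Rightarrow> real) \<Rightarrow> ('j \<Rightarrow> 'a) \<Rightarrow> 'j set \<Rightarrow> real" where
  "gram_sum c u I d z J = (\<Sum>i\<in>I. \<Sum>j\<in>J. c i * d j * (cmod (cinner (u i) (z j)))\<^sup>2)"

lemma gram_sum_commute: "gram_sum c u I d z J = gram_sum d z J c u I"
  unfolding gram_sum_def by (subst sum.swap) (simp add: cmod_cinner_commute mult.commute)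

text \<open>The square of the Hilbert--Schmidt norm of the operator \<^term>\<open>rank_sum c u I\<close> is
  \<^term>\<open>gram_sum c u I c u I\<close>; in particular it dominates the operator norm.\<close>

lemma rank_sum_bound:
  assumes "finite I"
  shows "(norm (rank_sum c u I v))\<^sup>2 \<le> gram_sum c u I c u I * (norm v)\<^sup>2"
    and "0 \<le> gram_sum c u I c u I"
proof -
  obtain E where E: "finite E" "orthonormal E" "\<And>i. i \<in> I \<Longrightarrow> orthoproj E (u i) = u i"
    using finite_orthonormal_cover[of "u ` I"] assms by auto
  have ex: "cinner x (u i) = (\<Sum>e\<in>E. cinner x e * cinner e (u i))" if "i \<in> I" for x i
  proof -
    have "cinner x (u i) = cinner x (orthoproj E (u i))" by (simp add: E that)
    also have "\<dots> = (\<Sum>e\<in>E. cinner x e * cinner e (u i))"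
      by (simp add: orthoproj_def cinner.sum_right cinner_scaleC_right cinner_commute[symmetric] mult.commute)
    finally show ?thesis .
  qed
  let ?D = "rank_sum c u I"
  \<comment> \<open>The trace may be computed in \<open>E\<close>: all \<open>u i\<close> lie in its
    span, so the operator vanishes on the orthogonal complement.\<close>
  have hs: "gram_sum c u I c u I = (\<Sum>e\<in>E. (norm (?D e))\<^sup>2)"
  proof -
    have "of_real (\<Sum>e\<in>E. (norm (?D e))\<^sup>2) = (\<Sum>e\<in>E. cinner (?D e) (?D e))"
      by (simp add: cinner_self)
    also have "\<dots> = (\<Sum>e\<in>E. \<Sum>i\<in>I. \<Sum>j\<in>I.
        of_real (c i * c j) * (cinner e (u i) * cnj (cinner e (u j)) * cinner (u i) (u j)))"
      unfolding rank_sum_def cinner.sum_left unfolding cinner.sum_right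
      by (simp add: cinner_scaleR_left cinner_scaleR_right cinner_scaleC_left cinner_scaleC_right
          scaleR_conv_of_real mult_ac)
    also have "\<dots> = (\<Sum>i\<in>I. \<Sum>j\<in>I. \<Sum>e\<in>E.
        of_real (c i * c j) * (cinner e (u i) * cnj (cinner e (u j)) * cinner (u i) (u j)))"
      by (subst sum.swap) (rule sum.cong[OF refl], rule sum.swap)
    also have "\<dots> = (\<Sum>i\<in>I. \<Sum>j\<in>I. of_real (c i * c j) * (cinner (u j) (u i) * cinner (u i) (u j)))"
    proof (intro sum.cong refl)
      fix i j assume "i \<in> I" "j \<in> I"
      show "(\<Sum>e\<in>E. of_real (c i * c j) * (cinner e (u i) * cnj (cinner e (u j)) * cinner (u i) (u j)))
        = of_real (c i * c j) * (cinner (u j) (u i) * cinner (u i) (u j))"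
        unfolding ex[OF \<open>i \<in> I\<close>, of "u j"] cinner_commute[symmetric]
        by (simp add: sum_distrib_left sum_distrib_right mult_ac)
    qed
    also have "\<dots> = of_real (gram_sum c u I c u I)"
      by (simp add: gram_sum_def cinner_mult_commute cmod_cinner_commute)
    finally show ?thesis by (metis of_real_eq_iff)
  qed
  show "0 \<le> gram_sum c u I c u I" by (simp add: hs sum_nonneg)
  \<comment> \<open>Thus \<open>?D v\<close> depends only on the coefficients of \<open>v\<close>
    along \<open>E\<close>; Cauchy-Schwarz and Bessel finish.\<close>
  have "?D v = (\<Sum>e\<in>E. cinner v e *\<^sub>C ?D e)"
  proof -
    have "?D v = (\<Sum>i\<in>I. \<Sum>e\<in>E. c i *\<^sub>R ((cinner v e * cinner e (u i)) *\<^sub>C u i))"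
      unfolding rank_sum_def
      by (rule sum.cong) (simp_all add: ex[of _ v] scaleC.sum_left scaleR_sum_right)
    also have "\<dots> = (\<Sum>e\<in>E. cinner v e *\<^sub>C ?D e)"
      unfolding rank_sum_def scaleC.sum_right
      by (subst sum.swap) (simp add: scaleC.scaleR_right scaleC_scaleC)
    finally show ?thesis .
  qed
  then have "norm (?D v) \<le> (\<Sum>e\<in>E. cmod (cinner v e) * norm (?D e))"
    by (simp add: norm_scaleC sum_norm_le)
  then have "(norm (?D v))\<^sup>2 \<le> (\<Sum>e\<in>E. cmod (cinner v e) * norm (?D e))\<^sup>2"
    by (simp add: power_mono)
  also have "\<dots> \<le> (\<Sum>e\<in>E. (cmod (cinner v e))\<^sup>2) * (\<Sum>e\<in>E. (norm (?D e))\<^sup>2)"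
    by (rule Cauchy_Schwarz_ineq_sum)
  also have "\<dots> \<le> (norm v)\<^sup>2 * gram_sum c u I c u I"
    unfolding hs by (intro mult_right_mono bessel E sum_nonneg) simp
  finally show "(norm (?D v))\<^sup>2 \<le> gram_sum c u I c u I * (norm v)\<^sup>2"
    by (simp add: mult.commute)
qed

text \<open>The difference is itself a \<open>rank_sum\<close> over the disjoint union, with the
  second weights negated, and \<open>h\<close> is its squared Hilbert-Schmidt norm. The inequality
  \<open>0 \<le> h\<close> is the later source of convexity.\<close>

lemma rank_sum_diff_bound:
  fixes c :: "'i \<Rightarrow> real" and u :: "'i \<Rightarrow> 'a::chilbert_space" and d :: "'j \<Rightarrow> real" and z :: "'j \<Rightarrow> 'a"
  assumes "finite I" "finite J"
  defines "h \<equiv> gram_sum c u I c u I + gram_sum d z J d z J - 2 * gram_sum c u I d z J"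
  shows "(norm (rank_sum c u I v - rank_sum d z J v))\<^sup>2 \<le> h * (norm v)\<^sup>2" and "0 \<le> h"
proof -
  define c' where "c' = case_sum c (\<lambda>j. - d j)"
  define u' where "u' = case_sum u z"
  have fin: "finite (I <+> J)" using assms by simp
  have split: "(\<Sum>i\<in>I <+> J. F i) = (\<Sum>i\<in>I. F (Inl i)) + (\<Sum>j\<in>J. F (Inr j))" for F :: "_ \<Rightarrow> 'c::comm_monoid_add"
    using sum.Plus[OF assms(1,2), of F] by simp
  have 1: "rank_sum c' u' (I <+> J) v = rank_sum c u I v - rank_sum d z J v"
    unfolding rank_sum_def split by (simp add: c'_def u'_def sum_negf)
  have 2: "gram_sum c' u' (I <+> J) c' u' (I <+> J) = h"
    using gram_sum_commute[of c u I d z J]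
    unfolding h_def gram_sum_def split
    by (simp add: c'_def u'_def sum_negf sum.distrib sum_subtractf)
  show "(norm (rank_sum c u I v - rank_sum d z J v))\<^sup>2 \<le> h * (norm v)\<^sup>2" "0 \<le> h"
    using rank_sum_bound(1)[OF fin, of c' u' v] rank_sum_bound(2)[OF fin, of c' u'] unfolding 1 2 by auto
qed

section \<open>Averages over the random walk\<close>

text \<open>The measure enters as a real function with an explicit finite support \<open>S\<close>,
  so that all expectations become finite sums.\<close>

locale symmetric_walk = group G for G :: "('g, 'm) monoid_scheme" (structure) +
  fixes q :: "'g \<Rightarrow> real" and S :: "'g set"
  assumes finite_S: "finite S"
    and S_sub: "S \<subseteq> carrier G"
    and q_pos: "s \<in> S \<Longrightarrow> 0 < q s"
    and q_zero: "x \<in> carrier G \<Longrightarrow> x \<notin> S \<Longrightarrow> q x = 0"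
    and q_sum: "sum q S = 1"
    and q_inv: "x \<in> carrier G \<Longrightarrow> q (inv x) = q x"
    and one_S: "\<one> \<in> S"
    and gen_S: "generate G S = carrier G"
begin

abbreviation walk :: "nat \<Rightarrow> 'g \<Rightarrow> real" where
  "walk n \<equiv> conv_power G q n"

text \<open>Carries the whole mass of \<open>walk n\<close> (\<open>walk_zero\<close>), which turns
  the infinite sums of the definitions into finite ones.\<close>

primrec walk_ball :: "nat \<Rightarrow> 'g set" where
  "walk_ball 0 = {\<one>}"
| "walk_ball (Suc n) = (\<Union>s\<in>S. (\<lambda>x. s \<otimes> x) ` walk_ball n)"

text \<open>Expectation of F(X_n). Reals, complex numbers and vectors of the representation space
  are all averaged, hence the general codomain.\<close>

definition avg :: "nat \<Rightarrow> ('g \<Rightarrow> 'b::real_vector) \<Rightarrow> 'b" where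
  "avg n F = (\<Sum>x\<in>walk_ball n. walk n x *\<^sub>R F x)"

declare conv_power.simps(2) [simp del]

lemma S_carrier [simp]: "s \<in> S \<Longrightarrow> s \<in> carrier G"
  using S_sub by auto

lemma inv_S: "s \<in> S \<Longrightarrow> inv s \<in> S"
  using q_zero[of "inv s"] q_inv[of s] q_pos[of s] by force

lemma finite_walk_ball [simp]: "finite (walk_ball n)"
  by (induction n) (auto simp: finite_S)

lemma walk_ball_carrier: "walk_ball n \<subseteq> carrier G"
proof (induction n)
  case (Suc n)
  then show ?case by (auto intro!: m_closed)
qed simp

lemma walk_ball_carrierD [simp]: "x \<in> walk_ball n \<Longrightarrow> x \<in> carrier G"
  using walk_ball_carrier by auto

lemma walk_ball_mult: "s \<in> S \<Longrightarrow> (\<lambda>x. s \<otimes> x) ` walk_ball n \<subseteq> walk_ball (Suc n)"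
  by auto

lemma walk_Suc:
  assumes "x \<in> carrier G"
  shows "walk (Suc n) x = (\<Sum>s\<in>S. q s * walk n (inv s \<otimes> x))"
proof -
  have "walk (Suc n) x = (\<Sum>\<^sub>\<infinity>s\<in>S. q s * walk n (inv s \<otimes> x))"
    unfolding conv_power.simps(2) convolution_def
    by (rule infsum_cong_neutral) (use q_zero in auto)
  then show ?thesis by (simp add: finite_S)
qed

lemma walk_nonneg: "x \<in> carrier G \<Longrightarrow> 0 \<le> walk n x"
proof (induction n arbitrary: x)
  case (Suc n)
  then show ?case
    unfolding walk_Suc[OF Suc.prems] by (intro sum_nonneg mult_nonneg_nonneg) (auto simp: q_pos less_imp_le)
qed simp

lemma walk_zero: "x \<in> carrier G \<Longrightarrow> x \<notin> walk_ball n \<Longrightarrow> walk n x = 0"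
proof (induction n arbitrary: x)
  case (Suc n)
  have "walk n (inv s \<otimes> x) = 0" if "s \<in> S" for s
  proof (rule Suc.IH)
    show "inv s \<otimes> x \<notin> walk_ball n"
    proof
      assume "inv s \<otimes> x \<in> walk_ball n"
      then have "s \<otimes> (inv s \<otimes> x) \<in> walk_ball (Suc n)" using that by auto
      then show False using Suc.prems that by (simp add: m_assoc[symmetric])
    qed
  qed (use Suc.prems that in auto)
  then show ?case unfolding walk_Suc[OF Suc.prems(1)] by simp
qed simp

text \<open>One term of the convolution. It says that the law of s X_n has density at most 1 / q s
  with respect to the law of X_(n+1); absolute continuity and the constants of the entropy bound
  come from this.\<close>

lemma walk_ge:
  assumes "s \<in> S" "x \<in> carrier G"
  shows "q s * walk n (inv s \<otimes> x) \<le> walk (Suc n) x"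
  unfolding walk_Suc[OF assms(2)]
  by (rule member_le_sum[of s S "\<lambda>s. q s * walk n (inv s \<otimes> x)"])
    (use assms in \<open>auto simp: finite_S q_pos less_imp_le intro!: mult_nonneg_nonneg walk_nonneg\<close>)

text \<open>The weight in the sum is the law of s X_n; \<open>C\<close> only has to be large enough
  to carry it.\<close>

lemma sum_walk_shift:
  assumes "finite C" "(\<lambda>x. s \<otimes> x) ` walk_ball n \<subseteq> C" "C \<subseteq> carrier G" "s \<in> carrier G"
  shows "(\<Sum>y\<in>C. walk n (inv s \<otimes> y) *\<^sub>R F y) = avg n (\<lambda>x. F (s \<otimes> x))"
proof -
  let ?T = "(\<lambda>x. s \<otimes> x)"
  have "(\<Sum>y\<in>C. walk n (inv s \<otimes> y) *\<^sub>R F y) = (\<Sum>y\<in>?T ` walk_ball n. walk n (inv s \<otimes> y) *\<^sub>R F y)"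
  proof (rule sum.mono_neutral_right[OF assms(1,2)], rule ballI)
    fix y assume y: "y \<in> C - ?T ` walk_ball n"
    have "inv s \<otimes> y \<notin> walk_ball n"
    proof
      assume "inv s \<otimes> y \<in> walk_ball n"
      then have "?T (inv s \<otimes> y) \<in> ?T ` walk_ball n" by blast
      moreover have "?T (inv s \<otimes> y) = y"
        using y assms by (auto simp: m_assoc[symmetric])
      ultimately show False using y by simp
    qed
    then show "walk n (inv s \<otimes> y) *\<^sub>R F y = 0"
      using y assms by (subst walk_zero) auto
  qed
  also have "\<dots> = avg n (\<lambda>x. F (s \<otimes> x))"
    unfolding avg_def
    by (subst sum.reindex) (use assms in \<open>auto intro!: inj_onI sum.cong simp: m_assoc[symmetric]\<close>)
  finally show ?thesis .
qed

lemma avg_0 [simp]: "avg 0 F = F \<one>"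
  by (simp add: avg_def)

lemma avg_Suc: "avg (Suc n) F = (\<Sum>s\<in>S. q s *\<^sub>R avg n (\<lambda>x. F (s \<otimes> x)))"
proof -
  have "avg (Suc n) F = (\<Sum>x\<in>walk_ball (Suc n). \<Sum>s\<in>S. q s *\<^sub>R (walk n (inv s \<otimes> x) *\<^sub>R F x))"
    unfolding avg_def
  proof (rule sum.cong[OF refl])
    fix x assume "x \<in> walk_ball (Suc n)"
    then have "x \<in> carrier G" by (rule walk_ball_carrierD)
    then show "walk (Suc n) x *\<^sub>R F x = (\<Sum>s\<in>S. q s *\<^sub>R (walk n (inv s \<otimes> x) *\<^sub>R F x))"
      by (simp add: walk_Suc scaleR_sum_left)
  qed
  also have "\<dots> = (\<Sum>s\<in>S. q s *\<^sub>R avg n (\<lambda>x. F (s \<otimes> x)))"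
  proof (subst sum.swap, rule sum.cong[OF refl])
    fix s assume s: "s \<in> S"
    show "(\<Sum>x\<in>walk_ball (Suc n). q s *\<^sub>R (walk n (inv s \<otimes> x) *\<^sub>R F x)) = q s *\<^sub>R avg n (\<lambda>x. F (s \<otimes> x))"
      unfolding scaleR_sum_right[symmetric]
      by (rule arg_cong[OF sum_walk_shift[OF finite_walk_ball walk_ball_mult[OF s] walk_ball_carrier S_carrier[OF s]]])
  qed
  finally show ?thesis .
qed

lemma avg_cong: "(\<And>x. x \<in> carrier G \<Longrightarrow> F x = F' x) \<Longrightarrow> avg n F = avg n F'"
  unfolding avg_def by (rule sum.cong) auto

lemma avg_plus: "avg n (\<lambda>x. F x + F' x) = avg n F + avg n F'"
  by (simp add: avg_def scaleR_right_distrib sum.distrib)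

lemma avg_diff: "avg n (\<lambda>x. F x - F' x) = avg n F - avg n F'"
  by (simp add: avg_def scaleR_right_diff_distrib sum_subtractf)

lemma avg_scaleR: "avg n (\<lambda>x. r *\<^sub>R F x) = r *\<^sub>R avg n F"
  by (simp add: avg_def scaleR_sum_right mult.commute)

lemma avg_mult: "avg n (\<lambda>x. r * F x) = r * avg n F" for r :: real
  using avg_scaleR[of n r F] by simp

lemma avg_sum: "avg n (\<lambda>x. \<Sum>i\<in>I. F i x) = (\<Sum>i\<in>I. avg n (F i))"
  unfolding avg_def scaleR_sum_right by (rule sum.swap)

lemma avg_swap: "avg m (\<lambda>x. avg n (\<lambda>y. F x y)) = avg n (\<lambda>y. avg m (\<lambda>x. F x y))"
  unfolding avg_def scaleR_sum_right by (subst sum.swap) (simp add: mult.commute)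

lemma avg_const: "avg n (\<lambda>_. c) = c"
  by (induction n) (simp_all add: avg_Suc scaleR_sum_left[symmetric] q_sum)

text \<open>The recursion adds steps on the left, but independent steps can be split off at either
  end. Cocycles along the walk need the last step on the right: b(x s) = b(x) + \<pi>_x
  b(s).\<close>

lemma avg_Suc_right: "avg (Suc n) F = (\<Sum>s\<in>S. q s *\<^sub>R avg n (\<lambda>x. F (x \<otimes> s)))"
proof (induction n arbitrary: F)
  case 0
  show ?case by (simp add: avg_Suc)
next
  case (Suc n)
  have "avg (Suc (Suc n)) F = (\<Sum>s\<in>S. q s *\<^sub>R (\<Sum>t\<in>S. q t *\<^sub>R avg n (\<lambda>x. F (s \<otimes> (x \<otimes> t)))))"
    unfolding avg_Suc[of "Suc n"] Suc.IH ..
  also have "\<dots> = (\<Sum>t\<in>S. q t *\<^sub>R (\<Sum>s\<in>S. q s *\<^sub>R avg n (\<lambda>x. F (s \<otimes> (x \<otimes> t)))))"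
    unfolding scaleR_sum_right by (subst sum.swap) (simp add: mult.commute)
  also have "\<dots> = (\<Sum>t\<in>S. q t *\<^sub>R avg (Suc n) (\<lambda>x. F (x \<otimes> t)))"
    unfolding avg_Suc[of n]
    by (intro sum.cong refl arg_cong2[where f = scaleR] avg_cong) (simp add: m_assoc)
  finally show ?case .
qed

lemma avg_add: "avg (m + n) F = avg m (\<lambda>x. avg n (\<lambda>y. F (x \<otimes> y)))"
proof (induction m arbitrary: F)
  case 0
  then show ?case by (simp, intro avg_cong) simp
next
  case (Suc m)
  have "avg (Suc m + n) F = (\<Sum>s\<in>S. q s *\<^sub>R avg m (\<lambda>x. avg n (\<lambda>y. F (s \<otimes> (x \<otimes> y)))))"
    by (simp add: avg_Suc Suc.IH)
  also have "\<dots> = avg (Suc m) (\<lambda>x. avg n (\<lambda>y. F (x \<otimes> y)))"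
    unfolding avg_Suc by (intro sum.cong refl arg_cong2[where f = scaleR] avg_cong) (simp add: m_assoc)
  finally show ?case .
qed

lemma sum_S_inv: "(\<Sum>s\<in>S. f (inv s)) = (\<Sum>s\<in>S. f s)"
  by (rule sum.reindex_bij_witness[of _ "\<lambda>s. inv s" "\<lambda>s. inv s"]) (auto simp: inv_S)

text \<open>Inversion reverses the order of the steps, so the left recursion meets
  \<open>avg_Suc_right\<close>; symmetry of \<open>q\<close> absorbs the inverses.\<close>

lemma avg_inv: "avg n (\<lambda>x. F (inv x)) = avg n F"
proof (induction n arbitrary: F)
  case (Suc n)
  have "avg (Suc n) (\<lambda>x. F (inv x)) = (\<Sum>s\<in>S. q s *\<^sub>R avg n (\<lambda>x. F (inv x \<otimes> inv s)))"
    unfolding avg_Suc by (intro sum.cong refl arg_cong2[where f = scaleR] avg_cong) (simp add: inv_mult_group)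
  also have "\<dots> = (\<Sum>s\<in>S. q (inv s) *\<^sub>R avg n (\<lambda>x. F (x \<otimes> inv s)))"
    using Suc.IH[of "\<lambda>x. F (x \<otimes> inv _)"] by (intro sum.cong) (simp_all add: q_inv)
  also have "\<dots> = avg (Suc n) F"
    unfolding avg_Suc_right by (rule sum_S_inv)
  finally show ?case .
qed simp

lemma avg_mono: "(\<And>x. x \<in> carrier G \<Longrightarrow> f x \<le> g x) \<Longrightarrow> avg n f \<le> avg n g" for f g :: "'g \<Rightarrow> real"
  unfolding avg_def by (rule sum_mono) (simp add: mult_left_mono walk_nonneg)

lemma avg_nonneg: "(\<And>x. x \<in> carrier G \<Longrightarrow> 0 \<le> f x) \<Longrightarrow> 0 \<le> avg n f" for f :: "'g \<Rightarrow> real"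
  unfolding avg_def by (rule sum_nonneg) (simp add: walk_nonneg)

lemma norm_avg_le: "norm (avg n F) \<le> avg n (\<lambda>x. norm (F x))" for F :: "'g \<Rightarrow> 'b::real_normed_vector"
  unfolding avg_def by (rule sum_norm_le) (simp add: walk_nonneg)

text \<open>Nonnegativity of the variance.\<close>

lemma avg_square_le: "(avg n f)\<^sup>2 \<le> avg n (\<lambda>x. (f x)\<^sup>2)" for f :: "'g \<Rightarrow> real"
proof -
  have "0 \<le> avg n (\<lambda>x. (f x - avg n f)\<^sup>2)" by (rule avg_nonneg) simp
  also have "(\<lambda>x. (f x - avg n f)\<^sup>2) = (\<lambda>x. ((f x)\<^sup>2 + (avg n f)\<^sup>2) - (2 * avg n f) * f x)"
    by (auto simp: power2_diff)
  also have "avg n \<dots> = avg n (\<lambda>x. (f x)\<^sup>2) - (avg n f)\<^sup>2"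
    by (simp add: avg_diff avg_plus avg_const avg_mult power2_eq_square)
  finally show ?thesis by simp
qed

end

section \<open>Finite-dimensional subspaces from Hilbert--Schmidt operators\<close>

lemma rank_sum_add: "rank_sum c u I (v + w) = rank_sum c u I v + rank_sum c u I w"
  by (simp add: rank_sum_def cinner_add_left scaleC_add_left scaleR_add_right sum.distrib)

lemma rank_sum_scaleC: "rank_sum c u I (a *\<^sub>C v) = a *\<^sub>C rank_sum c u I v"
  by (simp add: rank_sum_def cinner_scaleC_left scaleC.sum_right scaleC.scaleR_right scaleC_scaleC)

lemma rank_sum_selfadjoint: "cinner (rank_sum c u I x) y = cinner x (rank_sum c u I y)"
  unfolding rank_sum_def cinner.sum_left cinner.sum_right
  by (rule sum.cong)
    (simp_all add: cinner_scaleR_left cinner_scaleR_right cinner_scaleC_left cinner_scaleC_right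
      cinner_commute[symmetric] mult.commute)

text \<open>Each summand ranges over the image of a closed disc of the complex plane, so the image
  of the unit ball lies in a finite sum of compact sets.\<close>

lemma rank_sum_image_subset_compact:
  assumes "finite I"
  shows "\<exists>K. compact K \<and> rank_sum c u I ` cball 0 1 \<subseteq> K"
  using assms
proof (induction I)
  case empty
  show ?case by (rule exI[of _ "{0}"]) (auto simp: rank_sum_def)
next
  case (insert i I)
  then obtain K where K: "compact K" "rank_sum c u I ` cball 0 1 \<subseteq> K" by blast
  define L where "L = (\<lambda>z. c i *\<^sub>R (z *\<^sub>C u i)) ` cball 0 (norm (u i))"
  have "compact L"
    unfolding L_def by (intro compact_continuous_image continuous_intros scaleC.continuous_on) auto
  then have "compact {x + y |x y. x \<in> L \<and> y \<in> K}" using K(1) by (rule compact_sums)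
  moreover have "rank_sum c u (insert i I) v \<in> {x + y |x y. x \<in> L \<and> y \<in> K}" if "v \<in> cball 0 1" for v
  proof -
    have "cmod (cinner v (u i)) \<le> norm v * norm (u i)" by (rule cmod_cinner_le)
    also have "\<dots> \<le> norm (u i)" using that by (simp add: mult_left_le_one_le)
    finally have "c i *\<^sub>R (cinner v (u i) *\<^sub>C u i) \<in> L" by (auto simp: L_def)
    moreover have "rank_sum c u I v \<in> K" using K(2) that by auto
    ultimately show ?thesis using insert by (auto simp: rank_sum_def)
  qed
  ultimately show ?case by blast
qed

text \<open>Operator norm limits of finite-rank operators are compact: a finite net for the
  approximating operator is a coarser net for \<open>A\<close>.\<close>

lemma compact_closure_image:
  fixes A :: "'a::chilbert_space \<Rightarrow> 'a"
  assumes "\<And>e. e > 0 \<Longrightarrow> \<exists>c u (I :: 'i set). finite I \<and> (\<forall>v. norm (A v - rank_sum c u I v) \<le> e * norm v)"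
  shows "compact (closure (A ` cball 0 1))"
  unfolding compact_eq_totally_bounded
proof (intro conjI allI impI)
  show "Topological_Spaces.complete (closure (A ` cball 0 1))"
    by (simp add: complete_eq_closed)
  fix e :: real assume e: "e > 0"
  \<comment> \<open>One quarter for the approximation and one for the net give closed balls of
    radius e/2; a finite union of them is closed, so it also contains the closure.\<close>
  obtain c u and I :: "'i set" where I: "finite I" "\<And>v. norm (A v - rank_sum c u I v) \<le> e / 4 * norm v"
    using assms[of "e / 4"] e by auto
  obtain K where K: "compact K" "rank_sum c u I ` cball 0 1 \<subseteq> K"
    using rank_sum_image_subset_compact[OF I(1)] by blast
  obtain k where k: "finite k" "K \<subseteq> (\<Union>x\<in>k. ball x (e / 4))"
    using K(1) e unfolding compact_eq_totally_bounded by (meson divide_pos_pos zero_less_numeral)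
  have "A ` cball 0 1 \<subseteq> (\<Union>x\<in>k. cball x (e / 2))"
  proof
    fix y assume "y \<in> A ` cball 0 1"
    then obtain v where v: "norm v \<le> 1" "y = A v" by auto
    then obtain x where x: "x \<in> k" "dist x (rank_sum c u I v) < e / 4"
      using K(2) k(2) by (force simp: subset_iff)
    have "norm (A v - rank_sum c u I v) \<le> e / 4"
      using order_trans[OF I(2)[of v], of "e / 4"] v e by (simp add: mult_left_le)
    then have "dist x y \<le> e / 2"
      using x(2) v(2) dist_triangle[of x y "rank_sum c u I v"] by (simp add: dist_norm norm_minus_commute)
    then show "y \<in> (\<Union>x\<in>k. cball x (e / 2))" using x(1) by auto
  qed
  then have "closure (A ` cball 0 1) \<subseteq> (\<Union>x\<in>k. cball x (e / 2))"
    by (rule closure_minimal) (use k(1) in auto)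
  also have "\<dots> \<subseteq> (\<Union>x\<in>k. ball x e)" using e by fastforce
  finally show "\<exists>k. finite k \<and> closure (A ` cball 0 1) \<subseteq> (\<Union>x\<in>k. ball x e)"
    using k(1) by blast
qed

text \<open>If \<open>\<parallel>A v\<parallel>\<close> comes close to \<open>\<parallel>A\<parallel>\<close> for a unit vector \<open>v\<close>, then \<open>A\<^sup>2 v\<close> is close
  to \<open>\<parallel>A\<parallel>\<^sup>2 v\<close>; compactness turns such approximate eigenvectors into an eigenvector.\<close>

lemma selfadjoint_compact_eigenvector:
  fixes A :: "'a::chilbert_space \<Rightarrow> 'a"
  assumes A: "bounded_linear A"
    and sa: "\<And>x y. cinner (A x) y = cinner x (A y)"
    and cpt: "compact (closure (A ` cball 0 1))"
    and nz: "A w \<noteq> 0"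
  shows "\<exists>l>0. \<exists>y. y \<noteq> 0 \<and> A (A y) = l\<^sup>2 *\<^sub>R y"
proof -
  define l where "l = onorm A"
  have l: "l > 0" using onorm_pos_lt[OF A] nz unfolding l_def by blast
  have "\<exists>v. norm v = 1 \<and> norm (A v) > l - 1 / Suc n" for n
  proof -
    \<comment> \<open>\<open>onorm_bound\<close> asks for a nonnegative constant, hence the maximum
      with 0; still \<open>b < l\<close> because \<open>l > 0\<close>.\<close>
    define b where "b = max 0 (l - 1 / Suc n)"
    have "b < onorm A" using l by (simp add: b_def l_def)
    then have "\<exists>x. norm (A x) > b * norm x"
      using onorm_bound[of b A] by (force simp: b_def not_less)
    then obtain x where x: "norm (A x) > b * norm x" by blast
    then have "x \<noteq> 0" using bounded_linear.linear[OF A] linear_0 by fastforce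
    then have "norm (A ((1 / norm x) *\<^sub>R x)) > b"
      using x by (simp add: linear_cmul[OF bounded_linear.linear[OF A]] field_simps)
    then show ?thesis
      using \<open>x \<noteq> 0\<close> by (intro exI[of _ "(1 / norm x) *\<^sub>R x"]) (auto simp: b_def)
  qed
  then obtain v where v: "\<And>n. norm (v n) = 1" "\<And>n. norm (A (v n)) > l - 1 / Suc n"
    by metis
  have ub: "norm (A x) \<le> l * norm x" for x
    unfolding l_def by (rule onorm[OF A])
  have lim: "(\<lambda>n. norm (A (v n))) \<longlonglongrightarrow> l"
  proof (rule tendsto_sandwich[of "\<lambda>n. l - 1 / Suc n" _ _ "\<lambda>_. l"])
    show "(\<lambda>n. l - 1 / real (Suc n)) \<longlonglongrightarrow> l"
      using tendsto_diff[OF tendsto_const[of l] LIMSEQ_Suc[OF lim_1_over_n]] by simp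
  qed (use v ub[of "v _"] in \<open>auto simp: less_imp_le intro!: always_eventually\<close>)
  have "A (v n) \<in> closure (A ` cball 0 1)" for n
    using v(1)[of n] closure_subset[of "A ` cball 0 1"] by auto
  then obtain y r where r: "strict_mono (r :: nat \<Rightarrow> nat)" "((\<lambda>n. A (v n)) \<circ> r) \<longlonglongrightarrow> y"
    using cpt unfolding compact_def by metis
  \<comment> \<open>Expand the square as |A A x|^2 - 2 l^2 |A x|^2 + l^4 and use |A A x| <= l |A
    x|.\<close>
  have bd: "(norm (A (A x) - l\<^sup>2 *\<^sub>R x))\<^sup>2 \<le> l\<^sup>2 * (l\<^sup>2 - (norm (A x))\<^sup>2)" if "norm x = 1" for x
  proof -
    have "Re (cinner (A (A x)) (l\<^sup>2 *\<^sub>R x)) = l\<^sup>2 * (norm (A x))\<^sup>2"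
      unfolding cinner_scaleR_right by (simp add: sa[of "A x"] Re_cinner_self)
    moreover have "(norm (A (A x)))\<^sup>2 \<le> l\<^sup>2 * (norm (A x))\<^sup>2"
      using power_mono[OF ub[of "A x"], of 2] by (simp add: power_mult_distrib)
    ultimately show ?thesis
      unfolding norm_diff_squared using that by (simp add: power_mult_distrib algebra_simps power2_eq_square)
  qed
  have "(\<lambda>n. l\<^sup>2 * (l\<^sup>2 - (norm (A (v n)))\<^sup>2)) \<longlonglongrightarrow> l\<^sup>2 * (l\<^sup>2 - l\<^sup>2)"
    by (intro tendsto_intros lim)
  then have t: "(\<lambda>n. l\<^sup>2 * (l\<^sup>2 - (norm (A (v n)))\<^sup>2)) \<longlonglongrightarrow> 0" by simp
  have "(\<lambda>n. (norm (A (A (v n)) - l\<^sup>2 *\<^sub>R v n))\<^sup>2) \<longlonglongrightarrow> 0"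
    by (rule tendsto_sandwich[OF _ _ tendsto_const t]) (auto simp: bd v intro!: always_eventually)
  from tendsto_real_sqrt[OF this] have "(\<lambda>n. norm (A (A (v n)) - l\<^sup>2 *\<^sub>R v n)) \<longlonglongrightarrow> 0"
    by simp
  then have "((\<lambda>n. A (A (v n)) - l\<^sup>2 *\<^sub>R v n) \<circ> r) \<longlonglongrightarrow> 0"
    unfolding tendsto_norm_zero_iff by (rule LIMSEQ_subseq_LIMSEQ) (rule r)
  then have d: "(\<lambda>n. A (A (v (r n))) - l\<^sup>2 *\<^sub>R v (r n)) \<longlonglongrightarrow> 0" by (simp add: o_def)
  \<comment> \<open>The \<open>A (v (r n))\<close> converge to \<open>y\<close>. As A A v(r n) tends
    to \<open>A y\<close> and differs from l^2 v(r n) by a null sequence, the vectors l^2 v(r n)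
    tend to \<open>A y\<close> as well.\<close>
  note tA = bounded_linear.tendsto[OF A]
  have 1: "(\<lambda>n. A (v (r n))) \<longlonglongrightarrow> y" using r(2) by (simp add: o_def)
  have "(\<lambda>n. l\<^sup>2 *\<^sub>R v (r n)) \<longlonglongrightarrow> A y"
    using tendsto_diff[OF tA[OF 1] d] by simp
  from tA[OF this] have "(\<lambda>n. l\<^sup>2 *\<^sub>R A (v (r n))) \<longlonglongrightarrow> A (A y)"
    by (simp add: linear_cmul[OF bounded_linear.linear[OF A]])
  moreover have "(\<lambda>n. l\<^sup>2 *\<^sub>R A (v (r n))) \<longlonglongrightarrow> l\<^sup>2 *\<^sub>R y"
    by (intro tendsto_intros 1)
  ultimately have eig: "A (A y) = l\<^sup>2 *\<^sub>R y" by (rule LIMSEQ_unique)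
  have "(\<lambda>n. norm (A (v (r n)))) \<longlonglongrightarrow> l"
    using LIMSEQ_subseq_LIMSEQ[OF lim r(1)] by (simp add: o_def)
  then have "norm y = l"
    using tendsto_norm[OF 1] LIMSEQ_unique by blast
  then show ?thesis using eig l by (intro exI[of _ l]) auto
qed

lemma orthoproj_in_span: "orthoproj E v \<in> cspan E"
  unfolding orthoproj_def by (intro complex_vector.span_sum complex_vector.span_scale complex_vector.span_base)

text \<open>An orthonormal family in \<open>V\<close> of the greatest possible size spans
  \<open>V\<close>: otherwise Gram-Schmidt on a missing vector, which stays inside \<open>V\<close>,
  would enlarge it.\<close>

lemma finite_dim_if_orthonormal_bounded:
  assumes V: "csubspace V" and N: "\<And>E. finite E \<Longrightarrow> orthonormal E \<Longrightarrow> E \<subseteq> V \<Longrightarrow> card E \<le> N"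
  shows "\<exists>B. finite B \<and> V = cspan B"
proof -
  define P where "P n \<longleftrightarrow> (\<exists>E. finite E \<and> orthonormal E \<and> E \<subseteq> V \<and> card E = n)" for n
  have "P 0" unfolding P_def by (rule exI[of _ "{}"]) (simp add: orthonormal_def)
  moreover have "\<And>n. P n \<Longrightarrow> n \<le> N" using N by (auto simp: P_def)
  ultimately obtain n where n: "P n" "\<And>m. P m \<Longrightarrow> m \<le> n"
    using GreatestI_nat[of P 0 N] Greatest_le_nat[of P _ N] by blast
  then obtain E where E: "finite E" "orthonormal E" "E \<subseteq> V" "card E = n" by (auto simp: P_def)
  have sub: "cspan E \<subseteq> V" using complex_vector.span_minimal[OF E(3) V] .
  have "v \<in> cspan E" if v: "v \<in> V" for v
  proof (cases "v = orthoproj E v")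
    case True
    then show ?thesis using orthoproj_in_span[of E v] by simp
  next
    case False
    define e where "e = of_real (1 / norm (v - orthoproj E v)) *\<^sub>C (v - orthoproj E v)"
    note i = orthonormal_insert[OF E(2,1) False, folded e_def]
    have "e \<in> V"
      unfolding e_def using sub orthoproj_in_span[of E v] v
      by (intro complex_vector.subspace_scale complex_vector.subspace_diff V) auto
    then have "P (Suc n)"
      unfolding P_def using i E by (intro exI[of _ "insert e E"]) auto
    then show ?thesis using n(2) by fastforce
  qed
  then show ?thesis using sub E(1) by blast
qed

text \<open>Compactness yields an eigenvalue l^2 of A^2; passing to A^2 treats eigenvalues l and -l
  of A together. Finite dimension comes from the Hilbert-Schmidt bound \<open>C\<close>, of which
  each vector of an orthonormal family in the eigenspace uses up l^2.\<close>

lemma hilbert_schmidt_eigenspace: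
  fixes A :: "'a::chilbert_space \<Rightarrow> 'a"
  assumes A: "bounded_linear A"
    and sc: "\<And>a x. A (a *\<^sub>C x) = a *\<^sub>C A x"
    and sa: "\<And>x y. cinner (A x) y = cinner x (A y)"
    and ap: "\<And>e. e > 0 \<Longrightarrow> \<exists>c u (I :: 'i set). finite I \<and> (\<forall>v. norm (A v - rank_sum c u I v) \<le> e * norm v)"
    and hs: "\<And>E. finite E \<Longrightarrow> orthonormal E \<Longrightarrow> (\<Sum>e\<in>E. (norm (A e))\<^sup>2) \<le> C"
    and nz: "A w \<noteq> 0"
  obtains r where "csubspace {v. A (A v) = r *\<^sub>R v}" "{v. A (A v) = r *\<^sub>R v} \<noteq> {0}"
    "\<exists>B. finite B \<and> {v. A (A v) = r *\<^sub>R v} = cspan B"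
proof -
  obtain l y where l: "l > 0" "y \<noteq> 0" "A (A y) = l\<^sup>2 *\<^sub>R y"
    using selfadjoint_compact_eigenvector[OF A sa compact_closure_image[OF ap] nz] by blast
  define V where "V = {v. A (A v) = l\<^sup>2 *\<^sub>R v}"
  note lin = bounded_linear.linear[OF A]
  have V: "csubspace V"
    unfolding V_def
    by (rule complex_vector.subspaceI)
      (auto simp: linear_0[OF lin] linear_add[OF lin] scaleR_add_right sc scaleC.scaleR_right)
  have "card E \<le> nat \<lceil>C / l\<^sup>2\<rceil>" if E: "finite E" "orthonormal E" "E \<subseteq> V" for E
  proof -
    have "(norm (A e))\<^sup>2 = l\<^sup>2" if "e \<in> E" for e
    proof -
      have "cinner (A e) (A e) = cinner (l\<^sup>2 *\<^sub>R e) e"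
        using that E(3) sa[of "A e" e] by (auto simp: V_def)
      then have "complex_of_real ((norm (A e))\<^sup>2) = of_real (l\<^sup>2)"
        unfolding cinner_scaleR_left by (simp add: cinner_self orthonormal_norm[OF E(2) that] scaleR_conv_of_real)
      then show ?thesis by (simp only: of_real_eq_iff)
    qed
    then have "real (card E) * l\<^sup>2 \<le> C" using hs[OF E(1,2)] by simp
    then show ?thesis using l(1) by (simp add: pos_le_divide_eq[symmetric]) linarith
  qed
  then have "\<exists>B. finite B \<and> V = cspan B"
    by (rule finite_dim_if_orthonormal_bounded[OF V])
  moreover have "V \<noteq> {0}" using l by (auto simp: V_def)
  ultimately show thesis using that[of "l\<^sup>2"] V unfolding V_def by blast
qed

section \<open>Correlations of a unitary representation along the walk\<close>

locale walk_rep = symmetric_walk G q S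
  for G :: "('g, 'm) monoid_scheme" (structure) and q S +
  fixes \<pi> :: "'g \<Rightarrow> 'h \<Rightarrow> 'h::chilbert_space"
  assumes rep: "unitary_rep G \<pi>"
begin

lemma rep_unitary: "g \<in> carrier G \<Longrightarrow> unitary (\<pi> g)"
  using rep by (simp add: unitary_rep_def)

lemma rep_add: "g \<in> carrier G \<Longrightarrow> \<pi> g (x + y) = \<pi> g x + \<pi> g y"
  using rep_unitary[of g] by (simp add: unitary_def Vector_Spaces.linear_iff)

lemma rep_scaleC: "g \<in> carrier G \<Longrightarrow> \<pi> g (a *\<^sub>C x) = a *\<^sub>C \<pi> g x"
  using rep_unitary[of g] by (simp add: unitary_def Vector_Spaces.linear_iff)

lemma rep_scaleR: "g \<in> carrier G \<Longrightarrow> \<pi> g (a *\<^sub>R x) = a *\<^sub>R \<pi> g x"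
  by (simp add: scaleR_scaleC rep_scaleC)

lemma rep_zero [simp]: "g \<in> carrier G \<Longrightarrow> \<pi> g 0 = 0"
  using rep_add[of g 0 0] by simp

lemma rep_minus: "g \<in> carrier G \<Longrightarrow> \<pi> g (- x) = - \<pi> g x"
  using rep_scaleR[of g "-1" x] by simp

lemma rep_diff: "g \<in> carrier G \<Longrightarrow> \<pi> g (x - y) = \<pi> g x - \<pi> g y"
  using rep_add[of g x "- y"] by (simp add: rep_minus)

lemma rep_cinner: "g \<in> carrier G \<Longrightarrow> cinner (\<pi> g x) (\<pi> g y) = cinner x y"
  using rep_unitary[of g] by (simp add: unitary_def)

lemma norm_rep [simp]: "g \<in> carrier G \<Longrightarrow> norm (\<pi> g x) = norm x"
  by (simp add: norm_eq_sqrt_cinner rep_cinner)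

lemma rep_mult: "g \<in> carrier G \<Longrightarrow> h \<in> carrier G \<Longrightarrow> \<pi> (g \<otimes> h) x = \<pi> g (\<pi> h x)"
  using rep by (simp add: unitary_rep_def)

text \<open>\<open>unitary_rep\<close> records multiplicativity; \<pi> at the unit is therefore
  idempotent, and being surjective it is the identity.\<close>

lemma rep_one [simp]: "\<pi> \<one> x = x"
proof -
  obtain y where "x = \<pi> \<one> y"
    using rep_unitary[of \<one>] unfolding unitary_def by (metis one_closed surjD)
  then show ?thesis using rep_mult[of \<one> \<one> y] by simp
qed

lemma rep_inv [simp]: "g \<in> carrier G \<Longrightarrow> \<pi> (inv g) (\<pi> g x) = x"
  using rep_mult[of "inv g" g x] by simp

lemma cinner_rep_left: "g \<in> carrier G \<Longrightarrow> cinner (\<pi> g x) y = cinner x (\<pi> (inv g) y)"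
  using rep_cinner[of "inv g" "\<pi> g x" y] by simp

lemma cinner_rep_right: "g \<in> carrier G \<Longrightarrow> cinner x (\<pi> g y) = cinner (\<pi> (inv g) x) y"
  using cinner_rep_left[of "inv g" x y] by simp

lemma rep_sum: "g \<in> carrier G \<Longrightarrow> \<pi> g (\<Sum>i\<in>I. f i) = (\<Sum>i\<in>I. \<pi> g (f i))"
  by (induction I rule: infinite_finite_induct) (simp_all add: rep_add)

lemma tendsto_rep:
  assumes "g \<in> carrier G" "f \<longlonglongrightarrow> l"
  shows "(\<lambda>n. \<pi> g (f n)) \<longlonglongrightarrow> \<pi> g l"
proof -
  have "(\<lambda>n. norm (\<pi> g (f n) - \<pi> g l)) \<longlonglongrightarrow> 0"
    using tendsto_norm_zero[OF LIM_zero[OF assms(2)]] assms(1) by (simp add: rep_diff[symmetric])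
  then show ?thesis by (simp add: tendsto_norm_zero_iff LIM_zero_iff)
qed

text \<open>\<open>cov_op k w\<close> is the average of the conjugates of the rank one operator given by \<open>w\<close>,
  and the correlations are its Hilbert--Schmidt inner products.\<close>

definition cov_op :: "nat \<Rightarrow> 'h \<Rightarrow> 'h \<Rightarrow> 'h" where
  "cov_op k w = rank_sum (walk k) (\<lambda>x. \<pi> x w) (walk_ball k)"

definition corr :: "'h \<Rightarrow> nat \<Rightarrow> real" where
  "corr w n = avg n (\<lambda>x. (cmod (cinner (\<pi> x w) w))\<^sup>2)"

lemma gram_sum_walk: "gram_sum (walk j) u (walk_ball j) (walk l) z (walk_ball l)
    = avg j (\<lambda>x. avg l (\<lambda>y. (cmod (cinner (u x) (z y)))\<^sup>2))"
  by (simp add: gram_sum_def avg_def sum_distrib_left mult.assoc)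

text \<open>The inner product of the two vectors depends only on y^-1 s x, and y^-1 has the law of
  y. With \<open>s\<close> the unit this gives \<open>gram_walk\<close>; a general \<open>s\<close>
  measures the effect of conjugation.\<close>

lemma gram_shift:
  assumes "s \<in> carrier G"
  shows "gram_sum (walk j) (\<lambda>x. \<pi> (s \<otimes> x) w) (walk_ball j) (walk l) (\<lambda>x. \<pi> x w) (walk_ball l)
    = avg l (\<lambda>y. avg j (\<lambda>x. (cmod (cinner (\<pi> (y \<otimes> s \<otimes> x) w) w))\<^sup>2))"
proof -
  have "gram_sum (walk j) (\<lambda>x. \<pi> (s \<otimes> x) w) (walk_ball j) (walk l) (\<lambda>x. \<pi> x w) (walk_ball l)
    = avg l (\<lambda>y. avg j (\<lambda>x. (cmod (cinner (\<pi> (s \<otimes> x) w) (\<pi> y w)))\<^sup>2))"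
    unfolding gram_sum_walk by (rule avg_swap)
  also have "\<dots> = avg l (\<lambda>y. avg j (\<lambda>x. (cmod (cinner (\<pi> (inv y \<otimes> s \<otimes> x) w) w))\<^sup>2))"
    by (intro avg_cong) (simp add: assms cinner_rep_right rep_mult m_assoc)
  also have "\<dots> = avg l (\<lambda>y. avg j (\<lambda>x. (cmod (cinner (\<pi> (y \<otimes> s \<otimes> x) w) w))\<^sup>2))"
    by (rule avg_inv)
  finally show ?thesis .
qed

lemma gram_walk:
  "gram_sum (walk j) (\<lambda>x. \<pi> x w) (walk_ball j) (walk l) (\<lambda>x. \<pi> x w) (walk_ball l) = corr w (j + l)"
proof -
  have "gram_sum (walk j) (\<lambda>x. \<pi> x w) (walk_ball j) (walk l) (\<lambda>x. \<pi> x w) (walk_ball l)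
    = gram_sum (walk j) (\<lambda>x. \<pi> (\<one> \<otimes> x) w) (walk_ball j) (walk l) (\<lambda>x. \<pi> x w) (walk_ball l)"
    unfolding gram_sum_walk by (intro avg_cong) simp
  also have "\<dots> = avg l (\<lambda>y. avg j (\<lambda>x. (cmod (cinner (\<pi> (y \<otimes> x) w) w))\<^sup>2))"
    unfolding gram_shift[OF one_closed] by (intro avg_cong) simp
  also have "\<dots> = corr w (l + j)"
    unfolding corr_def by (rule avg_add[symmetric])
  finally show ?thesis by (simp add: add.commute)
qed

lemma gram_walk_self:
  "gram_sum (walk k) (\<lambda>x. \<pi> x w) (walk_ball k) (walk k) (\<lambda>x. \<pi> x w) (walk_ball k) = corr w (2 * k)"
  unfolding gram_walk mult_2 ..

lemma cov_op_bound: "(norm (cov_op k w v))\<^sup>2 \<le> corr w (2 * k) * (norm v)\<^sup>2"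
  using rank_sum_bound(1)[of "walk_ball k" "walk k" "\<lambda>x. \<pi> x w" v]
  by (simp add: cov_op_def gram_walk_self)

lemma cov_op_diff_bound:
  "(norm (cov_op j w v - cov_op l w v))\<^sup>2 \<le> (corr w (2 * j) + corr w (2 * l) - 2 * corr w (j + l)) * (norm v)\<^sup>2"
  "0 \<le> corr w (2 * j) + corr w (2 * l) - 2 * corr w (j + l)"
  using rank_sum_diff_bound[of "walk_ball j" "walk_ball l",
      where c = "walk j" and u = "\<lambda>x. \<pi> x w" and d = "walk l" and z = "\<lambda>x. \<pi> x w"]
  unfolding gram_walk_self gram_walk by (simp_all add: cov_op_def)

lemma corr_nonneg: "0 \<le> corr w n"
  unfolding corr_def by (rule avg_nonneg) simp

lemma corr_le: "corr w n \<le> (norm w) ^ 4"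
proof -
  have "corr w n \<le> avg n (\<lambda>_. (norm w) ^ 4)"
    unfolding corr_def
  proof (rule avg_mono)
    fix x assume "x \<in> carrier G"
    then have "(cmod (cinner (\<pi> x w) w))\<^sup>2 \<le> (norm w * norm w)\<^sup>2"
      using cmod_cinner_le[of "\<pi> x w" w] by (intro power_mono) simp_all
    then show "(cmod (cinner (\<pi> x w) w))\<^sup>2 \<le> (norm w) ^ 4"
      by (simp add: power2_eq_square power4_eq_xxxx)
  qed
  then show ?thesis by (simp add: avg_const)
qed

end

text \<open>By convexity one strict increase would recur, at least as large, at every later step,
  and linear growth contradicts the bound.\<close>

lemma convex_bounded_decseq:
  fixes E :: "nat \<Rightarrow> real"
  assumes conv: "\<And>i. 2 * E (Suc i) \<le> E i + E (Suc (Suc i))" and bd: "\<And>i. E i \<le> M"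
  shows "decseq E"
proof (rule decseq_SucI, rule ccontr)
  fix i assume "\<not> E (Suc i) \<le> E i"
  then have d: "E (Suc i) - E i > 0" by simp
  have step: "E (Suc (i + n)) - E (i + n) \<ge> E (Suc i) - E i" for n
  proof (induction n)
    case (Suc n)
    then show ?case using conv[of "i + n"] by simp
  qed simp
  have "E (i + n) \<ge> E i + n * (E (Suc i) - E i)" for n
  proof (induction n)
    case (Suc n)
    then show ?case using step[of n] by (simp add: algebra_simps)
  qed simp
  moreover obtain n :: nat where "n * (E (Suc i) - E i) > M - E i"
    using reals_Archimedean3[OF d] by blast
  ultimately show False using bd[of "i + n"] by (smt (verit))
qed

section \<open>Decay of matrix coefficients along the walk\<close>

context walk_rep
begin

lemma corr_even_convergent:
  obtains k where "decseq (\<lambda>i. corr w (2 * i))" "(\<lambda>i. corr w (2 * i)) \<longlonglongrightarrow> k" "\<And>i. k \<le> corr w (2 * i)" "0 \<le> k"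
proof -
  have dec: "decseq (\<lambda>i. corr w (2 * i))"
  proof (rule convex_bounded_decseq)
    fix i
    \<comment> \<open>The operators at times i and i + 2 have their inner product at index 2 i + 2,
      which is exactly the midpoint.\<close>
    show "2 * corr w (2 * Suc i) \<le> corr w (2 * i) + corr w (2 * Suc (Suc i))"
      using cov_op_diff_bound(2)[of w i "Suc (Suc i)"] by (simp add: eval_nat_numeral)
  qed (rule corr_le)
  obtain k where k: "(\<lambda>i. corr w (2 * i)) \<longlonglongrightarrow> k" "\<And>i. k \<le> corr w (2 * i)"
    by (rule decseq_convergent[OF dec allI[OF corr_nonneg]]) blast
  moreover have "0 \<le> k" by (rule LIMSEQ_le_const[OF k(1)]) (simp add: corr_nonneg)
  ultimately show thesis using that dec by blast
qed

text \<open>Quadratic form of \<open>cov_op\<close> (\<open>cinner_cov_op\<close>); for v = w it is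
  \<open>corr\<close>.\<close>

definition cov :: "'h \<Rightarrow> 'h \<Rightarrow> nat \<Rightarrow> real" where
  "cov w v n = avg n (\<lambda>x. (cmod (cinner (\<pi> x w) v))\<^sup>2)"

lemma cov_nonneg: "0 \<le> cov w v n"
  unfolding cov_def by (rule avg_nonneg) simp

lemma cinner_cov_op: "cinner (cov_op k w v) v = of_real (cov w v k)"
  unfolding cov_op_def rank_sum_def cov_def avg_def cinner.sum_left of_real_sum
  by (rule sum.cong)
    (simp_all add: cinner_scaleR_left cinner_scaleC_left cinner_mult_commute cmod_cinner_commute scaleR_conv_of_real)

text \<open>The quadratic form at time k is bounded by the operator norm, hence by the correlation
  at the even index 2k; so every k, odd or even, is covered.\<close>

lemma cov_le: "cov w v k \<le> sqrt (corr w (2 * k)) * (norm v)\<^sup>2"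
proof -
  have "cov w v k = cmod (cinner (cov_op k w v) v)"
    by (simp add: cinner_cov_op cov_nonneg)
  also have "\<dots> \<le> norm (cov_op k w v) * norm v" by (rule cmod_cinner_le)
  also have "norm (cov_op k w v) \<le> sqrt (corr w (2 * k)) * norm v"
    using real_sqrt_le_mono[OF cov_op_bound[of k w v]] by (simp add: real_sqrt_mult)
  finally show ?thesis by (simp add: power2_eq_square mult_right_mono)
qed

text \<open>Conjugation by s replaces x by s x in the rank one operators, at squared Hilbert-Schmidt
  distance 2 (corr(2k) - T s), where T inserts s into the middle of a path of length 2k. Averaging T
  over two steps gives corr(2k + 2). All deficits corr(2k) - T g are nonnegative, so the average
  dominates the contribution of the single path s, e, of weight \<open>q s * q \<one>\<close>. Two
  steps keep the index even.\<close>

lemma cov_op_conj_bound: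
  assumes s: "s \<in> S"
  shows "q s * q \<one> * (norm (\<pi> s (cov_op k w v) - cov_op k w (\<pi> s v)))\<^sup>2
    \<le> 2 * (corr w (2 * k) - corr w (2 * k + 2)) * (norm v)\<^sup>2"
proof -
  define T where "T g = avg k (\<lambda>y. avg k (\<lambda>x. (cmod (cinner (\<pi> (y \<otimes> g \<otimes> x) w) w))\<^sup>2))" for g
  let ?R = "\<lambda>g. rank_sum (walk k) (\<lambda>x. \<pi> (g \<otimes> x) w) (walk_ball k)"
  have self: "gram_sum (walk k) (\<lambda>x. \<pi> (g \<otimes> x) w) (walk_ball k) (walk k) (\<lambda>x. \<pi> (g \<otimes> x) w) (walk_ball k)
      = corr w (2 * k)" if "g \<in> carrier G" for g
  proof -
    have "gram_sum (walk k) (\<lambda>x. \<pi> (g \<otimes> x) w) (walk_ball k) (walk k) (\<lambda>x. \<pi> (g \<otimes> x) w) (walk_ball k)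
      = gram_sum (walk k) (\<lambda>x. \<pi> x w) (walk_ball k) (walk k) (\<lambda>x. \<pi> x w) (walk_ball k)"
      unfolding gram_sum_walk by (intro avg_cong) (simp add: that rep_mult rep_cinner)
    then show ?thesis by (simp add: gram_walk_self)
  qed
  have b: "(norm (?R g x - cov_op k w x))\<^sup>2 \<le> 2 * (corr w (2 * k) - T g) * (norm x)\<^sup>2"
      "0 \<le> 2 * (corr w (2 * k) - T g)" if "g \<in> carrier G" for g x
    using rank_sum_diff_bound[of "walk_ball k" "walk_ball k",
        where c = "walk k" and u = "\<lambda>x. \<pi> (g \<otimes> x) w" and d = "walk k" and z = "\<lambda>x. \<pi> x w"]
      self[OF that] gram_shift[OF that, of k w k]
    by (simp_all add: cov_op_def gram_walk_self T_def)
  have "corr w (2 * k + 2) = avg k (\<lambda>y. avg 2 (\<lambda>g. avg k (\<lambda>x. (cmod (cinner (\<pi> (y \<otimes> g \<otimes> x) w) w))\<^sup>2)))"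
  proof -
    have "corr w (2 * k + 2) = corr w (k + (2 + k))" by (rule arg_cong) simp
    also have "\<dots> = avg k (\<lambda>y. avg 2 (\<lambda>g. avg k (\<lambda>x. (cmod (cinner (\<pi> (y \<otimes> (g \<otimes> x)) w) w))\<^sup>2)))"
      unfolding corr_def avg_add ..
    also have "\<dots> = avg k (\<lambda>y. avg 2 (\<lambda>g. avg k (\<lambda>x. (cmod (cinner (\<pi> (y \<otimes> g \<otimes> x) w) w))\<^sup>2)))"
      by (intro avg_cong) (simp add: m_assoc)
    finally show ?thesis .
  qed
  then have avT: "corr w (2 * k + 2) = avg 2 T" unfolding T_def by (subst avg_swap)
  have "q s * (q \<one> * (corr w (2 * k) - T s)) \<le> avg 2 (\<lambda>g. corr w (2 * k) - T g)"
  proof -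
    have "q \<one> * (corr w (2 * k) - T s) \<le> (\<Sum>t\<in>S. q t * (corr w (2 * k) - T (s \<otimes> t)))"
      using member_le_sum[of \<one> S "\<lambda>t. q t * (corr w (2 * k) - T (s \<otimes> t))"] s b(2)[of "s \<otimes> _"]
      by (simp add: one_S finite_S q_pos less_imp_le)
    then have "q s * (q \<one> * (corr w (2 * k) - T s)) \<le> q s * (\<Sum>t\<in>S. q t * (corr w (2 * k) - T (s \<otimes> t)))"
      by (intro mult_left_mono) (use q_pos[OF s] in auto)
    also have "\<dots> \<le> (\<Sum>r\<in>S. q r * (\<Sum>t\<in>S. q t * (corr w (2 * k) - T (r \<otimes> t))))"
      using member_le_sum[of s S "\<lambda>r. q r * (\<Sum>t\<in>S. q t * (corr w (2 * k) - T (r \<otimes> t)))"] s b(2)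
      by (simp add: finite_S q_pos less_imp_le sum_nonneg)
    also have "\<dots> = avg 2 (\<lambda>g. corr w (2 * k) - T g)"
      by (simp add: numeral_2_eq_2 avg_Suc)
    finally show ?thesis .
  qed
  also have "\<dots> = corr w (2 * k) - corr w (2 * k + 2)"
    by (simp only: avg_diff avg_const avT)
  finally have c: "q s * q \<one> * (corr w (2 * k) - T s) \<le> corr w (2 * k) - corr w (2 * k + 2)"
    by (simp add: mult.assoc)
  have "\<pi> s (cov_op k w v) = ?R s (\<pi> s v)"
    unfolding cov_op_def rank_sum_def
    by (simp add: s rep_sum rep_scaleR rep_scaleC rep_mult rep_cinner)
  then have "q s * q \<one> * (norm (\<pi> s (cov_op k w v) - cov_op k w (\<pi> s v)))\<^sup>2
      \<le> q s * q \<one> * (2 * (corr w (2 * k) - T s) * (norm v)\<^sup>2)"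
    using b(1)[of s "\<pi> s v"] s q_pos[OF s] q_pos[OF one_S] by (intro mult_left_mono) simp_all
  also have "\<dots> = 2 * (q s * q \<one> * (corr w (2 * k) - T s)) * (norm v)\<^sup>2" by simp
  also have "\<dots> \<le> 2 * (corr w (2 * k) - corr w (2 * k + 2)) * (norm v)\<^sup>2"
    using c by (intro mult_right_mono mult_left_mono) simp_all
  finally show ?thesis .
qed

text \<open>Jensen brings the square inside the average, and Bessel bounds the sum over
  \<open>E\<close> pointwise. The bound is uniform in k and \<open>E\<close>, so it survives the
  limit.\<close>

lemma cov_op_hs:
  assumes "finite E" "orthonormal E"
  shows "(\<Sum>e\<in>E. (norm (cov_op k w e))\<^sup>2) \<le> (norm w) ^ 4"
proof -
  have "(norm (cov_op k w e))\<^sup>2 \<le> avg k (\<lambda>x. (cmod (cinner (\<pi> x w) e))\<^sup>2) * (norm w)\<^sup>2" for e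
  proof -
    have "norm (cov_op k w e) = norm (avg k (\<lambda>x. cinner e (\<pi> x w) *\<^sub>C \<pi> x w))"
      by (simp add: cov_op_def rank_sum_def avg_def)
    also have "\<dots> \<le> avg k (\<lambda>x. norm (cinner e (\<pi> x w) *\<^sub>C \<pi> x w))" by (rule norm_avg_le)
    also have "\<dots> = avg k (\<lambda>x. norm w * cmod (cinner (\<pi> x w) e))"
      by (intro avg_cong) (simp add: norm_scaleC cmod_cinner_commute mult.commute)
    finally have "norm (cov_op k w e) \<le> norm w * avg k (\<lambda>x. cmod (cinner (\<pi> x w) e))"
      by (simp add: avg_mult)
    then have "(norm (cov_op k w e))\<^sup>2 \<le> (norm w)\<^sup>2 * (avg k (\<lambda>x. cmod (cinner (\<pi> x w) e)))\<^sup>2"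
      unfolding power_mult_distrib[symmetric] by (rule power_mono) simp
    also have "\<dots> \<le> (norm w)\<^sup>2 * avg k (\<lambda>x. (cmod (cinner (\<pi> x w) e))\<^sup>2)"
      by (intro mult_left_mono avg_square_le) simp
    finally show ?thesis by (simp add: mult.commute)
  qed
  then have "(\<Sum>e\<in>E. (norm (cov_op k w e))\<^sup>2)
      \<le> (\<Sum>e\<in>E. avg k (\<lambda>x. (cmod (cinner (\<pi> x w) e))\<^sup>2) * (norm w)\<^sup>2)"
    by (rule sum_mono)
  also have "\<dots> = avg k (\<lambda>x. \<Sum>e\<in>E. (cmod (cinner (\<pi> x w) e))\<^sup>2) * (norm w)\<^sup>2"
    by (simp add: avg_sum sum_distrib_right)
  also have "\<dots> \<le> avg k (\<lambda>x. (norm w)\<^sup>2) * (norm w)\<^sup>2"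
  proof (intro mult_right_mono avg_mono)
    fix x assume "x \<in> carrier G"
    then show "(\<Sum>e\<in>E. (cmod (cinner (\<pi> x w) e))\<^sup>2) \<le> (norm w)\<^sup>2"
      using bessel[OF assms(2,1), of "\<pi> x w"] by simp
  qed simp
  finally show ?thesis by (simp add: avg_const power2_eq_square power4_eq_xxxx)
qed

text \<open>Commuting with the generators is inherited by products, and \<open>S\<close> is closed
  under inverses, so it holds on the whole group.\<close>

lemma eigenspace_invariant:
  assumes "\<And>s v. s \<in> S \<Longrightarrow> \<pi> s (A v) = A (\<pi> s v)" "g \<in> carrier G"
  shows "\<pi> g ` {v. A (A v) = r *\<^sub>R v} \<subseteq> {v. A (A v) = r *\<^sub>R v}"
proof -
  have gen: "g \<in> generate G S \<Longrightarrow> g \<in> carrier G \<and> (\<forall>v. \<pi> g (A v) = A (\<pi> g v))" for g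
  proof (induction g rule: generate.induct)
    case (eng h1 h2)
    then show ?case by (simp add: rep_mult)
  qed (use assms inv_S in auto)
  have "\<pi> g (A v) = A (\<pi> g v)" for v using gen[of g] assms(2) gen_S by simp
  then have "A (A (\<pi> g v)) = r *\<^sub>R \<pi> g v" if "A (A v) = r *\<^sub>R v" for v
    using that rep_scaleR[OF assms(2), of r v] by metis
  then show ?thesis by auto
qed

proposition weakly_mixing_cov:
  assumes wm: "weakly_mixing G \<pi>"
  shows "cov w v \<longlonglongrightarrow> 0"
proof -
  define E where "E i = corr w (2 * i)" for i
  obtain k where k: "decseq E" "E \<longlonglongrightarrow> k" "\<And>i. k \<le> E i" "0 \<le> k"
    using corr_even_convergent[of w] unfolding E_def by metis
  have "k = 0"
  proof (rule ccontr)
    assume "k \<noteq> 0"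
    then have kpos: "k > 0" using k(4) by simp
    \<comment> \<open>Doubled times make the Hilbert-Schmidt inner product of \<open>B j\<close> and
      \<open>B l\<close> equal to E(j + l): every one is an even-index correlation and tends to
      k.\<close>
    define B where "B j = cov_op (2 * j) w" for j
    \<comment> \<open>The squared distance is at most E(2j) + E(2l) - 2 E(j + l), and for j <= l
      monotonicity bounds this by 2 (E j - k).\<close>
    define d where "d j = sqrt (2 * (E j - k))" for j
    have dlim: "d \<longlonglongrightarrow> 0"
    proof -
      have "(\<lambda>j. sqrt (2 * (E j - k))) \<longlonglongrightarrow> sqrt (2 * (k - k))"
        by (intro tendsto_intros k)
      then show ?thesis by (simp add: d_def[abs_def])
    qed
    have cauchy: "norm (B j v - B l v) \<le> d j * norm v" if "j \<le> l" for j l v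
    proof -
      have "E (2 * j) \<le> E j" "E (2 * l) \<le> E j" "k \<le> E (j + l)"
        using decseqD[OF k(1)] that k(3) by simp_all
      then have "corr w (2 * (2 * j)) + corr w (2 * (2 * l)) - 2 * corr w (2 * j + 2 * l) \<le> 2 * (E j - k)"
        by (simp add: E_def)
      then have "(norm (B j v - B l v))\<^sup>2 \<le> 2 * (E j - k) * (norm v)\<^sup>2"
        unfolding B_def by (rule order_trans[OF cov_op_diff_bound(1) mult_right_mono]) simp
      from real_sqrt_le_mono[OF this] show ?thesis
        by (simp add: d_def real_sqrt_mult)
    qed
    have conv: "convergent (\<lambda>j. B j v)" for v
    proof (rule Cauchy_convergent, rule CauchyI')
      fix e :: real assume e: "e > 0"
      have "(\<lambda>j. d j * norm v) \<longlonglongrightarrow> 0 * norm v"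
        by (intro tendsto_intros dlim)
      then have "eventually (\<lambda>j. d j * norm v < e) sequentially"
        using e by (simp add: order_tendstoD)
      then obtain M where "\<And>j. j \<ge> M \<Longrightarrow> d j * norm v < e"
        by (auto simp: eventually_sequentially)
      then have "\<forall>m\<ge>M. \<forall>n>m. dist (B m v) (B n v) < e"
        unfolding dist_norm by (meson cauchy le_less_trans less_imp_le)
      then show "\<exists>M. \<forall>m\<ge>M. \<forall>n>m. dist (B m v) (B n v) < e" ..
    qed
    define A where "A v = lim (\<lambda>j. B j v)" for v
    have lim: "(\<lambda>j. B j v) \<longlonglongrightarrow> A v" for v
      using conv[of v] by (simp add: A_def convergent_LIMSEQ_iff)
    have approx: "norm (A v - B j v) \<le> d j * norm v" for v j
    proof -
      have "(\<lambda>l. norm (B l v - B j v)) \<longlonglongrightarrow> norm (A v - B j v)"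
        by (intro tendsto_intros lim)
      then show ?thesis
        by (rule LIMSEQ_le_const2) (metis cauchy norm_minus_commute)
    qed
    have A_add: "A (x + y) = A x + A y" for x y
    proof (rule LIMSEQ_unique[OF lim])
      show "(\<lambda>j. B j (x + y)) \<longlonglongrightarrow> A x + A y"
        using tendsto_add[OF lim[of x] lim[of y]] by (simp add: B_def cov_op_def rank_sum_add)
    qed
    have A_scaleC: "A (a *\<^sub>C x) = a *\<^sub>C A x" for a x
    proof (rule LIMSEQ_unique[OF lim])
      show "(\<lambda>j. B j (a *\<^sub>C x)) \<longlonglongrightarrow> a *\<^sub>C A x"
        using scaleC.tendsto[OF tendsto_const[of a] lim[of x]] by (simp add: B_def cov_op_def rank_sum_scaleC)
    qed
    have "norm (A v) \<le> norm v * (d 0 + norm w ^ 2)" for v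
    proof -
      have "norm (A v) \<le> norm (A v - B 0 v) + norm (B 0 v)"
        using norm_triangle_ineq[of "A v - B 0 v" "B 0 v"] by simp
      moreover have "norm (B 0 v) \<le> (norm w)\<^sup>2 * norm v"
      proof -
        have "(norm (B 0 v))\<^sup>2 \<le> corr w (2 * (2 * 0)) * (norm v)\<^sup>2"
          unfolding B_def by (rule cov_op_bound)
        also have "\<dots> \<le> (norm w) ^ 4 * (norm v)\<^sup>2"
          by (intro mult_right_mono corr_le) simp
        also have "\<dots> = ((norm w)\<^sup>2 * norm v)\<^sup>2"
          by (simp add: power_mult_distrib)
        finally show ?thesis by (rule power2_le_imp_le) simp
      qed
      ultimately show ?thesis using approx[of v 0] by (simp add: algebra_simps)
    qed
    then have bl: "bounded_linear A"
      by (intro bounded_linear_intro[where K = "d 0 + norm w ^ 2"] A_add) (simp_all add: scaleR_scaleC A_scaleC)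
    have sa: "cinner (A x) y = cinner x (A y)" for x y
    proof (rule LIMSEQ_unique)
      show "(\<lambda>j. cinner (B j x) y) \<longlonglongrightarrow> cinner (A x) y"
        by (rule cinner.tendsto[OF lim tendsto_const])
      show "(\<lambda>j. cinner (B j x) y) \<longlonglongrightarrow> cinner x (A y)"
        using cinner.tendsto[OF tendsto_const[of x] lim[of y]]
        by (simp add: B_def cov_op_def rank_sum_selfadjoint)
    qed
    have ap: "\<exists>c u (I :: 'g set). finite I \<and> (\<forall>v. norm (A v - rank_sum c u I v) \<le> e * norm v)" if e: "e > 0" for e
    proof -
      obtain j where "d j < e"
        using order_tendstoD(2)[OF dlim e] by (auto simp: eventually_sequentially)
      then have "\<forall>v. norm (A v - B j v) \<le> e * norm v"
        using approx[of _ j] by (meson less_imp_le mult_right_mono norm_ge_zero order_trans)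
      then show ?thesis
        unfolding B_def cov_op_def using finite_walk_ball by blast
    qed
    have hs: "(\<Sum>e\<in>F. (norm (A e))\<^sup>2) \<le> (norm w) ^ 4" if "finite F" "orthonormal F" for F
    proof (rule LIMSEQ_le_const2)
      show "(\<lambda>j. \<Sum>e\<in>F. (norm (B j e))\<^sup>2) \<longlonglongrightarrow> (\<Sum>e\<in>F. (norm (A e))\<^sup>2)"
        by (intro tendsto_intros lim)
      show "\<exists>N. \<forall>n\<ge>N. (\<Sum>e\<in>F. (norm (B n e))\<^sup>2) \<le> (norm w) ^ 4"
        using cov_op_hs[OF that] by (simp add: B_def)
    qed
    \<comment> \<open>Tested on \<open>w\<close> itself: <B_j w, w> = E j, which tends to k >
      0.\<close>
    have "A w \<noteq> 0"
    proof
      assume 0: "A w = 0"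
      have "(\<lambda>j. Re (cinner (B j w) w)) \<longlonglongrightarrow> Re (cinner (A w) w)"
        by (intro tendsto_Re cinner.tendsto lim tendsto_const)
      moreover have "Re (cinner (B j w) w) = E j" for j
        by (simp add: B_def cinner_cov_op cov_def E_def corr_def)
      ultimately have "E \<longlonglongrightarrow> 0" using 0 by simp
      then show False using LIMSEQ_unique[OF k(2)] kpos by auto
    qed
    then obtain r where r: "csubspace {v. A (A v) = r *\<^sub>R v}" "{v. A (A v) = r *\<^sub>R v} \<noteq> {0}"
        "\<exists>B. finite B \<and> {v. A (A v) = r *\<^sub>R v} = cspan B"
      using hilbert_schmidt_eigenspace[OF bl A_scaleC sa ap hs] by blast
    have "\<pi> s (A v) = A (\<pi> s v)" if s: "s \<in> S" for s v
    proof -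
      have qq: "q s * q \<one> > 0" using q_pos[OF s] q_pos[OF one_S] by simp
      \<comment> \<open>Correlations at 4j and 4j + 2 are the consecutive terms E(2j) and E(2j + 1),
        whose difference tends to 0.\<close>
      have le: "(norm (\<pi> s (B j v) - B j (\<pi> s v)))\<^sup>2 \<le> 2 * (E (2 * j) - E (Suc (2 * j))) * (norm v)\<^sup>2 / (q s * q \<one>)" for j
        using cov_op_conj_bound[OF s, of "2 * j" w v] qq
        by (simp add: E_def B_def pos_le_divide_eq mult.commute)
      have st: "strict_mono (\<lambda>j::nat. 2 * j)" "strict_mono (\<lambda>j::nat. Suc (2 * j))"
        by (auto intro: strict_monoI)
      have "(\<lambda>j. 2 * (E (2 * j) - E (Suc (2 * j))) * (norm v)\<^sup>2 / (q s * q \<one>)) \<longlonglongrightarrow> 2 * (k - k) * (norm v)\<^sup>2 / (q s * q \<one>)"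
        using LIMSEQ_subseq_LIMSEQ[OF k(2) st(1)] LIMSEQ_subseq_LIMSEQ[OF k(2) st(2)] qq
        by (intro tendsto_intros) (auto simp: o_def)
      then have t: "(\<lambda>j. 2 * (E (2 * j) - E (Suc (2 * j))) * (norm v)\<^sup>2 / (q s * q \<one>)) \<longlonglongrightarrow> 0" by simp
      have "(\<lambda>j. (norm (\<pi> s (B j v) - B j (\<pi> s v)))\<^sup>2) \<longlonglongrightarrow> 0"
        by (rule tendsto_sandwich[OF _ _ tendsto_const t]) (use le in \<open>auto intro!: always_eventually\<close>)
      from tendsto_real_sqrt[OF this] have "(\<lambda>j. \<pi> s (B j v) - B j (\<pi> s v)) \<longlonglongrightarrow> 0"
        by (simp add: tendsto_norm_zero_iff)
      moreover have "(\<lambda>j. \<pi> s (B j v)) \<longlonglongrightarrow> \<pi> s (A v)"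
        using s by (intro tendsto_rep lim) simp
      ultimately have "(\<lambda>j. B j (\<pi> s v)) \<longlonglongrightarrow> \<pi> s (A v)"
        using tendsto_diff[of "\<lambda>j. \<pi> s (B j v)" "\<pi> s (A v)" sequentially "\<lambda>j. \<pi> s (B j v) - B j (\<pi> s v)" 0]
        by simp
      then show ?thesis
        by (rule LIMSEQ_unique) (rule lim)
    qed
    then have "\<forall>g\<in>carrier G. \<pi> g ` {v. A (A v) = r *\<^sub>R v} \<subseteq> {v. A (A v) = r *\<^sub>R v}"
      by (intro ballI eigenspace_invariant) auto
    with r have "\<not> weakly_mixing G \<pi>"
      unfolding weakly_mixing_def not_not
      by - (rule exI[of _ "{v. A (A v) = r *\<^sub>R v}"], (rule conjI, assumption)+, assumption)
    then show False using wm by simp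
  qed
  have "(\<lambda>n. sqrt (E n) * (norm v)\<^sup>2) \<longlonglongrightarrow> sqrt k * (norm v)\<^sup>2"
    by (intro tendsto_intros k)
  then have t: "(\<lambda>n. sqrt (E n) * (norm v)\<^sup>2) \<longlonglongrightarrow> 0"
    using \<open>k = 0\<close> by simp
  show ?thesis
    by (rule tendsto_sandwich[OF _ _ tendsto_const t])
      (simp_all add: cov_nonneg cov_le E_def)
qed

end

section \<open>Entropy increments bound harmonic functions\<close>

text \<open>Squared Hellinger distance is at most relative entropy: termwise ln t <= t - 1 at t =
  sqrt(Q/P). Equality of the masses turns the sum of 2P - 2 sqrt(PQ) into that of (sqrt P - sqrt
  Q)^2.\<close>

lemma sum_sqrt_diff_le_relative_entropy:
  fixes P Q :: "'c \<Rightarrow> real"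
  assumes P: "\<And>y. y \<in> C \<Longrightarrow> 0 \<le> P y" and Q: "\<And>y. y \<in> C \<Longrightarrow> 0 \<le> Q y"
    and ac: "\<And>y. y \<in> C \<Longrightarrow> 0 < P y \<Longrightarrow> 0 < Q y" and eq: "sum P C = sum Q C"
  shows "(\<Sum>y\<in>C. (sqrt (P y) - sqrt (Q y))\<^sup>2) \<le> (\<Sum>y\<in>C. P y * (ln (P y) - ln (Q y)))"
proof -
  have "2 * P y - 2 * (sqrt (P y) * sqrt (Q y)) \<le> P y * (ln (P y) - ln (Q y))" if y: "y \<in> C" for y
  proof (cases "P y = 0")
    case False
    then have p: "P y > 0" "Q y > 0" using P[OF y] ac[OF y] by auto
    define t where "t = sqrt (Q y / P y)"
    have t: "t > 0" using p by (simp add: t_def)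
    have "ln (Q y) - ln (P y) = 2 * ln t"
      using p by (simp add: t_def ln_sqrt ln_div)
    also have "\<dots> \<le> 2 * (t - 1)" using ln_le_minus_one[OF t] by simp
    finally have "2 - 2 * t \<le> ln (P y) - ln (Q y)" by simp
    then have "P y * (2 - 2 * t) \<le> P y * (ln (P y) - ln (Q y))"
      using p by (intro mult_left_mono) simp_all
    moreover have "P y * t = sqrt (P y) * sqrt (Q y)"
      using p real_sqrt_mult_self[of "P y"] by (simp add: t_def real_sqrt_divide field_simps)
    ultimately show ?thesis by (simp add: algebra_simps)
  qed simp
  then have "(\<Sum>y\<in>C. 2 * P y - 2 * (sqrt (P y) * sqrt (Q y))) \<le> (\<Sum>y\<in>C. P y * (ln (P y) - ln (Q y)))"
    by (rule sum_mono)
  moreover have "(\<Sum>y\<in>C. (sqrt (P y) - sqrt (Q y))\<^sup>2) = (\<Sum>y\<in>C. P y + Q y - 2 * (sqrt (P y) * sqrt (Q y)))"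
    by (rule sum.cong) (simp_all add: power2_diff P Q)
  moreover have "\<dots> = (\<Sum>y\<in>C. 2 * P y - 2 * (sqrt (P y) * sqrt (Q y)))"
    using eq by (simp add: sum_subtractf sum.distrib sum_distrib_left[symmetric])
  ultimately show ?thesis by simp
qed

text \<open>Factor P - Q = (sqrt P - sqrt Q)(sqrt P + sqrt Q) and apply Cauchy-Schwarz. Unlike a
  total variation bound, this asks only for second moments of f.\<close>

lemma expectation_diff_bound:
  fixes P Q :: "'c \<Rightarrow> real" and f :: "'c \<Rightarrow> complex"
  assumes P: "\<And>y. y \<in> C \<Longrightarrow> 0 \<le> P y" and Q: "\<And>y. y \<in> C \<Longrightarrow> 0 \<le> Q y"
  shows "(cmod (\<Sum>y\<in>C. (P y - Q y) *\<^sub>R f y))\<^sup>2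
    \<le> (\<Sum>y\<in>C. (sqrt (P y) - sqrt (Q y))\<^sup>2) * (2 * (\<Sum>y\<in>C. (P y + Q y) * (cmod (f y))\<^sup>2))"
proof -
  have "cmod (\<Sum>y\<in>C. (P y - Q y) *\<^sub>R f y)
      \<le> (\<Sum>y\<in>C. \<bar>sqrt (P y) - sqrt (Q y)\<bar> * ((sqrt (P y) + sqrt (Q y)) * cmod (f y)))"
  proof (rule sum_norm_le)
    fix y assume y: "y \<in> C"
    have "P y - Q y = (sqrt (P y) - sqrt (Q y)) * (sqrt (P y) + sqrt (Q y))"
      using P[OF y] Q[OF y] by (simp add: algebra_simps)
    then show "cmod ((P y - Q y) *\<^sub>R f y) \<le> \<bar>sqrt (P y) - sqrt (Q y)\<bar> * ((sqrt (P y) + sqrt (Q y)) * cmod (f y))"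
      using P[OF y] Q[OF y] by (simp add: abs_mult)
  qed
  then have "(cmod (\<Sum>y\<in>C. (P y - Q y) *\<^sub>R f y))\<^sup>2
      \<le> (\<Sum>y\<in>C. \<bar>sqrt (P y) - sqrt (Q y)\<bar> * ((sqrt (P y) + sqrt (Q y)) * cmod (f y)))\<^sup>2"
    by (rule power_mono) simp
  also have "\<dots> \<le> (\<Sum>y\<in>C. \<bar>sqrt (P y) - sqrt (Q y)\<bar>\<^sup>2) * (\<Sum>y\<in>C. ((sqrt (P y) + sqrt (Q y)) * cmod (f y))\<^sup>2)"
    by (rule Cauchy_Schwarz_ineq_sum)
  also have "\<dots> \<le> (\<Sum>y\<in>C. (sqrt (P y) - sqrt (Q y))\<^sup>2) * (2 * (\<Sum>y\<in>C. (P y + Q y) * (cmod (f y))\<^sup>2))"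
  proof (rule mult_mono)
    have "((sqrt (P y) + sqrt (Q y)) * cmod (f y))\<^sup>2 \<le> 2 * ((P y + Q y) * (cmod (f y))\<^sup>2)" if y: "y \<in> C" for y
    proof -
      have "(sqrt (P y) + sqrt (Q y))\<^sup>2 \<le> 2 * (P y + Q y)"
        using sum_squares_bound[of "sqrt (P y)" "sqrt (Q y)"] P[OF y] Q[OF y] by (simp add: power2_sum)
      then have "(sqrt (P y) + sqrt (Q y))\<^sup>2 * (cmod (f y))\<^sup>2 \<le> 2 * (P y + Q y) * (cmod (f y))\<^sup>2"
        by (rule mult_right_mono) simp
      then show ?thesis by (simp only: power_mult_distrib mult.assoc)
    qed
    then show "(\<Sum>y\<in>C. ((sqrt (P y) + sqrt (Q y)) * cmod (f y))\<^sup>2) \<le> 2 * (\<Sum>y\<in>C. (P y + Q y) * (cmod (f y))\<^sup>2)"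
      unfolding sum_distrib_left by (rule sum_mono)
  qed (auto intro: sum_nonneg)
  finally show ?thesis .
qed

section \<open>Relative entropy of consecutive laws\<close>

context symmetric_walk
begin

abbreviation entropy_step :: "nat \<Rightarrow> real" where
  "entropy_step n \<equiv> shannon_entropy G (walk (n + 1)) - shannon_entropy G (walk n)"

lemma entropy_eq_avg: "shannon_entropy G (walk n) = - avg n (\<lambda>x. ln (walk n x))"
proof -
  have "(\<Sum>\<^sub>\<infinity>x\<in>carrier G. walk n x * ln (walk n x)) = (\<Sum>\<^sub>\<infinity>x\<in>walk_ball n. walk n x * ln (walk n x))"
    by (rule infsum_cong_neutral) (use walk_zero in auto)
  then show ?thesis by (simp add: shannon_entropy_def avg_def)
qed

lemma walk_shift_nonneg: "s \<in> S \<Longrightarrow> y \<in> carrier G \<Longrightarrow> 0 \<le> walk n (inv s \<otimes> y)"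
  by (intro walk_nonneg) auto

lemma sum_shift_ball:
  assumes "s \<in> S"
  shows "(\<Sum>y\<in>walk_ball (Suc n). walk n (inv s \<otimes> y) *\<^sub>R F y) = avg n (\<lambda>x. F (s \<otimes> x))"
  by (rule sum_walk_shift[OF finite_walk_ball walk_ball_mult[OF assms] walk_ball_carrier S_carrier[OF assms]])

text \<open>The entropy increment is the average over \<open>s\<close> of the relative entropy of the law of
  \<open>s X\<^sub>n\<close> with respect to the law of \<open>X\<^sub>n\<^sub>+\<^sub>1\<close>.\<close>

lemma entropy_step_eq:
  "entropy_step n = (\<Sum>s\<in>S. q s * (\<Sum>y\<in>walk_ball (Suc n).
     walk n (inv s \<otimes> y) * (ln (walk n (inv s \<otimes> y)) - ln (walk (Suc n) y))))"
proof -
  have "(\<Sum>y\<in>walk_ball (Suc n). walk n (inv s \<otimes> y) * (ln (walk n (inv s \<otimes> y)) - ln (walk (Suc n) y)))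
      = avg n (\<lambda>x. ln (walk n x)) - avg n (\<lambda>x. ln (walk (Suc n) (s \<otimes> x)))" if s: "s \<in> S" for s
  proof -
    have "(\<Sum>y\<in>walk_ball (Suc n). walk n (inv s \<otimes> y) * ln (walk n (inv s \<otimes> y)))
        = avg n (\<lambda>x. ln (walk n (inv s \<otimes> (s \<otimes> x))))"
      using sum_shift_ball[OF s, of n "\<lambda>y. ln (walk n (inv s \<otimes> y))"] unfolding real_scaleR_def .
    also have "\<dots> = avg n (\<lambda>x. ln (walk n x))"
      by (rule avg_cong) (simp add: s m_assoc[symmetric])
    finally have "(\<Sum>y\<in>walk_ball (Suc n). walk n (inv s \<otimes> y) * ln (walk n (inv s \<otimes> y)))
        = avg n (\<lambda>x. ln (walk n x))" .
    moreover have "(\<Sum>y\<in>walk_ball (Suc n). walk n (inv s \<otimes> y) * ln (walk (Suc n) y))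
        = avg n (\<lambda>x. ln (walk (Suc n) (s \<otimes> x)))"
      using sum_shift_ball[OF s, of n "\<lambda>y. ln (walk (Suc n) y)"] unfolding real_scaleR_def .
    ultimately show ?thesis by (simp add: right_diff_distrib sum_subtractf del: walk_ball.simps)
  qed
  then have "(\<Sum>s\<in>S. q s * (\<Sum>y\<in>walk_ball (Suc n).
      walk n (inv s \<otimes> y) * (ln (walk n (inv s \<otimes> y)) - ln (walk (Suc n) y))))
    = (\<Sum>s\<in>S. q s * (avg n (\<lambda>x. ln (walk n x)) - avg n (\<lambda>x. ln (walk (Suc n) (s \<otimes> x)))))"
    by simp
  also have "\<dots> = avg n (\<lambda>x. ln (walk n x)) - avg (Suc n) (\<lambda>x. ln (walk (Suc n) x))"
    by (simp add: avg_Suc right_diff_distrib sum_subtractf sum_distrib_right[symmetric] q_sum)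
  finally show ?thesis by (simp add: entropy_eq_avg)
qed

text \<open>c is the difference of the expectations of f under the laws P of s X_n and Q of X_(n+1).
  One factor \<open>q s\<close> comes from keeping a single term of the nonnegative sum for the
  entropy step, the other from q s P <= Q, which trades the second moment under P for that under Q.
  The 4 is 2 from \<open>expectation_diff_bound\<close> times 2 from q s (P + Q) <= 2 Q.\<close>

lemma harmonic_entropy_bound:
  fixes f :: "'g \<Rightarrow> complex"
  assumes s: "s \<in> S" and f1: "avg n (\<lambda>x. f (s \<otimes> x)) = c" and f0: "avg (Suc n) f = 0"
  shows "(q s)\<^sup>2 * (cmod c)\<^sup>2 \<le> 4 * entropy_step n * avg (Suc n) (\<lambda>x. (cmod (f x))\<^sup>2)" "0 \<le> entropy_step n"
proof -
  let ?C = "walk_ball (Suc n)"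
  define P where "P t y = walk n (inv t \<otimes> y)" for t y
  define Q where "Q = walk (Suc n)"
  define D where "D t = (\<Sum>y\<in>?C. P t y * (ln (P t y) - ln (Q y)))" for t
  have P: "0 \<le> P t y" if "t \<in> S" "y \<in> ?C" for t y
    unfolding P_def by (rule walk_shift_nonneg) (use that walk_ball_carrierD in blast)+
  have Q: "0 \<le> Q y" if "y \<in> ?C" for y
    unfolding Q_def by (rule walk_nonneg) (rule walk_ball_carrierD[OF that])
  have PQ: "q t * P t y \<le> Q y" if "t \<in> S" "y \<in> ?C" for t y
    unfolding P_def Q_def by (rule walk_ge[OF that(1) walk_ball_carrierD[OF that(2)]])
  have sP: "sum (P t) ?C = 1" if "t \<in> S" for t
    using sum_shift_ball[OF that, of n "\<lambda>_. 1 :: real"] by (simp add: P_def avg_const del: walk_ball.simps)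
  have sQ: "sum Q ?C = 1"
    using avg_const[of "Suc n" "1 :: real"] by (simp add: avg_def Q_def del: walk_ball.simps)
  have hell: "(\<Sum>y\<in>?C. (sqrt (P t y) - sqrt (Q y))\<^sup>2) \<le> D t" if t: "t \<in> S" for t
    unfolding D_def
  proof (rule sum_sqrt_diff_le_relative_entropy)
    fix y assume "y \<in> ?C" "0 < P t y"
    then show "0 < Q y" using PQ[OF t, of y] q_pos[OF t] by (smt (verit) mult_pos_pos)
  qed (use P[OF t] Q sP[OF t] sQ in auto)
  then have D: "0 \<le> D t" if "t \<in> S" for t
    using that by (meson order_trans sum_nonneg zero_le_power2)
  have H: "entropy_step n = (\<Sum>t\<in>S. q t * D t)"
    unfolding entropy_step_eq D_def P_def Q_def ..
  then show "0 \<le> entropy_step n"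
    using D by (simp add: sum_nonneg q_pos less_imp_le)
  have qD: "q s * D s \<le> entropy_step n"
    unfolding H by (rule member_le_sum[OF s]) (use D in \<open>auto simp: finite_S q_pos less_imp_le\<close>)
  have q1: "q s \<le> 1"
    using member_le_sum[OF s, of q] q_sum finite_S by (simp add: q_pos less_imp_le)
  define V where "V = (\<Sum>y\<in>?C. Q y * (cmod (f y))\<^sup>2)"
  have V: "V = avg (Suc n) (\<lambda>x. (cmod (f x))\<^sup>2)"
    by (simp add: V_def avg_def Q_def del: walk_ball.simps)
  have V0: "0 \<le> V" unfolding V_def using Q by (intro sum_nonneg) auto
  have "c = (\<Sum>y\<in>?C. (P s y - Q y) *\<^sub>R f y)"
    using f1 f0 sum_shift_ball[OF s, of n f]
    by (simp add: P_def Q_def avg_def scaleR_left_diff_distrib sum_subtractf del: walk_ball.simps)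
  then have "(cmod c)\<^sup>2 \<le> (\<Sum>y\<in>?C. (sqrt (P s y) - sqrt (Q y))\<^sup>2) * (2 * (\<Sum>y\<in>?C. (P s y + Q y) * (cmod (f y))\<^sup>2))"
    using expectation_diff_bound[of ?C "P s" Q f] P[OF s] Q by blast
  also have "\<dots> \<le> D s * (2 * (\<Sum>y\<in>?C. (P s y + Q y) * (cmod (f y))\<^sup>2))"
    by (intro mult_right_mono hell s mult_nonneg_nonneg sum_nonneg add_nonneg_nonneg P Q) auto
  finally have "q s * (q s * (cmod c)\<^sup>2) \<le> q s * (q s * (D s * (2 * (\<Sum>y\<in>?C. (P s y + Q y) * (cmod (f y))\<^sup>2))))"
    using q_pos[OF s] by (intro mult_left_mono) auto
  also have "\<dots> = (q s * D s) * (2 * (\<Sum>y\<in>?C. q s * (P s y + Q y) * (cmod (f y))\<^sup>2))"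
    by (simp add: sum_distrib_left mult_ac)
  also have "\<dots> \<le> entropy_step n * (2 * (2 * V))"
  proof (rule mult_mono[OF qD mult_left_mono])
    have "q s * (P s y + Q y) * (cmod (f y))\<^sup>2 \<le> 2 * (Q y * (cmod (f y))\<^sup>2)" if y: "y \<in> ?C" for y
    proof -
      have "q s * (P s y + Q y) \<le> 2 * Q y"
        using PQ[OF s y] mult_right_mono[OF q1 Q[OF y]] by (simp add: distrib_left)
      then have "q s * (P s y + Q y) * (cmod (f y))\<^sup>2 \<le> 2 * Q y * (cmod (f y))\<^sup>2"
        by (rule mult_right_mono) simp
      then show ?thesis by simp
    qed
    then show "(\<Sum>y\<in>?C. q s * (P s y + Q y) * (cmod (f y))\<^sup>2) \<le> 2 * V"
      unfolding V_def sum_distrib_left by (rule sum_mono)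
  next
    show "0 \<le> 2 * (\<Sum>y\<in>?C. q s * (P s y + Q y) * (cmod (f y))\<^sup>2)"
      using q_pos[OF s]
      by (intro mult_nonneg_nonneg sum_nonneg add_nonneg_nonneg P Q s) auto
  qed (use \<open>0 \<le> entropy_step n\<close> in auto)
  finally show "(q s)\<^sup>2 * (cmod c)\<^sup>2 \<le> 4 * entropy_step n * avg (Suc n) (\<lambda>x. (cmod (f x))\<^sup>2)"
    unfolding V by (simp add: power2_eq_square algebra_simps)
qed

end

text \<open>Cesaro: beyond some N each increment is below e/2, and the remaining e/2 per step
  absorbs the constants.\<close>

lemma sublinear_if_increments_vanish:
  fixes V :: "nat \<Rightarrow> real"
  assumes "(\<lambda>n. V (Suc n) - V n) \<longlonglongrightarrow> 0" "e > 0"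
  shows "eventually (\<lambda>n. V (Suc n) \<le> e * real n) sequentially"
proof -
  have "eventually (\<lambda>n. V (Suc n) - V n < e / 2) sequentially"
    using order_tendstoD(2)[OF assms(1), of "e / 2"] assms(2) by simp
  then obtain N where N: "\<And>n. n \<ge> N \<Longrightarrow> V (Suc n) - V n < e / 2"
    by (auto simp: eventually_sequentially)
  have le: "V (N + m) \<le> V N + real m * (e / 2)" for m
  proof (induction m)
    case (Suc m)
    then show ?case using N[of "N + m"] by (simp add: field_simps)
  qed simp
  \<comment> \<open>Large enough for half of e n to absorb both |V N| and the extra e/2 due to the
    shift to \<open>Suc n\<close>.\<close>
  obtain M :: nat where M: "real M * e > 2 * \<bar>V N\<bar> + e"
    using reals_Archimedean3[OF assms(2)] by blast
  have "V (Suc n) \<le> e * real n" if n: "n \<ge> N + M" for n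
  proof -
    have "V (Suc n) \<le> V N + real (Suc n - N) * (e / 2)"
      using le[of "Suc n - N"] n by simp
    also have "real (Suc n - N) * (e / 2) \<le> real (Suc n) * (e / 2)"
      using assms(2) by (intro mult_right_mono) auto
    finally have 1: "V (Suc n) \<le> \<bar>V N\<bar> + (real n + 1) * (e / 2)"
      using abs_ge_self[of "V N"] by (simp add: add.commute)
    have "real M * e \<le> real n * e" using n assms(2) by (intro mult_right_mono) auto
    with 1 M show ?thesis by (simp add: field_simps)
  qed
  then show ?thesis unfolding eventually_sequentially by blast
qed

section \<open>Harmonic cocycles\<close>

context walk_rep
begin

text \<open>Since b(g s) = b(g) + \<pi>_g b(s), mean zero of the first step says that b is harmonic
  at every g.\<close>

definition harmonic_cocycle :: "('g \<Rightarrow> 'h) \<Rightarrow> bool" where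
  "harmonic_cocycle b \<longleftrightarrow> b \<in> cocycles G \<pi> \<and> (\<Sum>s\<in>S. q s *\<^sub>R b s) = 0"

lemma cocycle_mult: "b \<in> cocycles G \<pi> \<Longrightarrow> g \<in> carrier G \<Longrightarrow> x \<in> carrier G \<Longrightarrow> b (g \<otimes> x) = b g + \<pi> g (b x)"
  by (simp add: cocycles_def)

lemma cocycle_one: "b \<in> cocycles G \<pi> \<Longrightarrow> b \<one> = 0"
  using cocycle_mult[of b \<one> \<one>] by simp

lemma cocycle_inv: "b \<in> cocycles G \<pi> \<Longrightarrow> g \<in> carrier G \<Longrightarrow> b (inv g) = - \<pi> (inv g) (b g)"
  using cocycle_mult[of b "inv g" g] by (simp add: cocycle_one eq_neg_iff_add_eq_0)

lemma cocycle_zero_if_zero_on_S: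
  assumes b: "b \<in> cocycles G \<pi>" and z: "\<And>s. s \<in> S \<Longrightarrow> b s = 0" and g: "g \<in> carrier G"
  shows "b g = 0"
proof -
  have "g \<in> generate G S \<Longrightarrow> g \<in> carrier G \<and> b g = 0" for g
  proof (induction g rule: generate.induct)
    case (eng h1 h2)
    then show ?case using cocycle_mult[OF b] by simp
  qed (use z inv_S cocycle_one[OF b] in auto)
  then show ?thesis using g gen_S by blast
qed

lemma avg_rep: "g \<in> carrier G \<Longrightarrow> avg n (\<lambda>x. \<pi> g (F x)) = \<pi> g (avg n F)"
  by (simp add: avg_def rep_sum rep_scaleR)

lemma avg_cinner: "avg n (\<lambda>x. cinner (F x) v) = cinner (avg n F) v"
  by (simp add: avg_def cinner.sum_left cinner_scaleR_left)

lemma avg_harmonic_shift: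
  assumes b: "b \<in> cocycles G \<pi>" and 0: "avg n b = 0" and g: "g \<in> carrier G"
  shows "avg n (\<lambda>x. b (g \<otimes> x)) = b g"
proof -
  have "avg n (\<lambda>x. b (g \<otimes> x)) = avg n (\<lambda>x. b g + \<pi> g (b x))"
    by (rule avg_cong) (rule cocycle_mult[OF b g])
  also have "\<dots> = b g" using g by (simp add: avg_plus avg_const avg_rep 0)
  finally show ?thesis .
qed

lemma avg_harmonic:
  assumes "harmonic_cocycle b"
  shows "avg n b = 0"
proof (induction n)
  case 0
  then show ?case using assms cocycle_one by (simp add: harmonic_cocycle_def)
next
  case (Suc n)
  have "avg (Suc n) b = (\<Sum>s\<in>S. q s *\<^sub>R b s)"
    unfolding avg_Suc using assms Suc
    by (intro sum.cong) (simp_all add: avg_harmonic_shift harmonic_cocycle_def)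
  then show ?case using assms by (simp add: harmonic_cocycle_def)
qed

definition spread :: "('g \<Rightarrow> 'h) \<Rightarrow> 'h \<Rightarrow> nat \<Rightarrow> real" where
  "spread b v n = avg n (\<lambda>x. (cmod (cinner (b x) v))\<^sup>2)"

text \<open>Harmonicity makes the increments of \<open>b\<close> along the walk orthogonal on average.\<close>

lemma spread_Suc:
  assumes b: "harmonic_cocycle b"
  shows "spread b v (Suc n) = spread b v n + (\<Sum>s\<in>S. q s * cov (b s) v n)"
proof -
  have bc: "b \<in> cocycles G \<pi>" and bh: "(\<Sum>s\<in>S. q s *\<^sub>R b s) = 0"
    using b by (auto simp: harmonic_cocycle_def)
  \<comment> \<open>Cross term of the expanded square. It is real linear in \<open>b s\<close>, so
    averaging over s evaluates it at the mean of b, which is 0.\<close>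
  define X where "X x s = 2 * Re (cinner (b x) v * cnj (cinner (\<pi> x (b s)) v))" for x s
  have sq: "(cmod (y + z))\<^sup>2 = (cmod y)\<^sup>2 + (cmod z)\<^sup>2 + 2 * Re (y * cnj z)" for y z :: complex
    by (simp add: cmod_power2 power2_sum)
  have "(cmod (cinner (b (x \<otimes> s)) v))\<^sup>2 = (cmod (cinner (b x) v))\<^sup>2 + (cmod (cinner (\<pi> x (b s)) v))\<^sup>2 + X x s"
    if "s \<in> S" "x \<in> carrier G" for s x
    using cocycle_mult[OF bc, of x s] that by (simp add: cinner_add_left sq X_def)
  then have "spread b v (Suc n) = (\<Sum>s\<in>S. q s *\<^sub>R avg n (\<lambda>x.
      (cmod (cinner (b x) v))\<^sup>2 + (cmod (cinner (\<pi> x (b s)) v))\<^sup>2 + X x s))"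
    unfolding spread_def avg_Suc_right
    by (intro sum.cong refl arg_cong2[where f = scaleR] avg_cong) auto
  also have "\<dots> = (\<Sum>s\<in>S. q s * spread b v n + q s * cov (b s) v n + q s * avg n (\<lambda>x. X x s))"
    by (simp add: avg_plus spread_def cov_def algebra_simps)
  also have "\<dots> = spread b v n + (\<Sum>s\<in>S. q s * cov (b s) v n) + (\<Sum>s\<in>S. q s * avg n (\<lambda>x. X x s))"
    by (simp add: sum.distrib sum_distrib_right[symmetric] q_sum)
  also have "(\<Sum>s\<in>S. q s * avg n (\<lambda>x. X x s)) = avg n (\<lambda>x. \<Sum>s\<in>S. q s * X x s)"
    by (simp add: avg_sum avg_mult)
  also have "\<dots> = avg n (\<lambda>x. 0)"
  proof (rule avg_cong)
    fix x assume x: "x \<in> carrier G"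
    have "(\<Sum>s\<in>S. q s * X x s) = 2 * Re (cinner (b x) v * cnj (cinner (\<pi> x (\<Sum>s\<in>S. q s *\<^sub>R b s)) v))"
      unfolding X_def
      by (simp only: rep_sum[OF x] rep_scaleR[OF x] cinner.sum_left cinner_scaleR_left cnj_sum sum_distrib_left Re_sum)
        (simp add: algebra_simps sum_distrib_left)
    then show "(\<Sum>s\<in>S. q s * X x s) = 0" unfolding bh using x by simp
  qed
  finally show ?thesis by (simp add: avg_const)
qed

text \<open>Entropy step times n is bounded infinitely often, while spread divided by n tends to 0.
  At a common n their product is as small as desired, yet with v = b s it dominates a fixed positive
  multiple of |b s|^4.\<close>

proposition harmonic_cocycle_zero:
  assumes b: "harmonic_cocycle b" and wm: "weakly_mixing G \<pi>"
    and slow: "frequently (\<lambda>n. real n * entropy_step n \<le> L) sequentially"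
    and s: "s \<in> S"
  shows "b s = 0"
proof -
  define v where "v = b s"
  have bc: "b \<in> cocycles G \<pi>" using b by (simp add: harmonic_cocycle_def)
  have "(\<lambda>n. \<Sum>s\<in>S. q s * cov (b s) v n) \<longlonglongrightarrow> (\<Sum>s\<in>S. q s * 0)"
    by (intro tendsto_intros weakly_mixing_cov wm)
  then have inc: "(\<lambda>n. spread b v (Suc n) - spread b v n) \<longlonglongrightarrow> 0"
    by (simp add: spread_Suc[OF b])
  define c where "c = (q s)\<^sup>2 * (cmod (cinner (b s) v))\<^sup>2"
  have bound: "c \<le> 4 * entropy_step n * spread b v (Suc n)" "0 \<le> entropy_step n" for n
  proof -
    have 0: "avg n (\<lambda>x. cinner (b x) v) = 0" for n
      by (simp only: avg_cinner avg_harmonic[OF b] cinner_zero_left)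
    have 1: "avg n (\<lambda>x. cinner (b (s \<otimes> x)) v) = cinner (b s) v"
      by (simp only: avg_cinner avg_harmonic_shift[OF bc avg_harmonic[OF b] S_carrier[OF s]])
    show "c \<le> 4 * entropy_step n * spread b v (Suc n)" "0 \<le> entropy_step n"
      unfolding c_def spread_def
      by (rule harmonic_entropy_bound[where f = "\<lambda>x. cinner (b x) v", OF s 1 0])+
  qed
  have "c \<le> e" if e: "e > 0" for e
  proof -
    \<comment> \<open>A positive substitute for \<open>L\<close>, by which one can divide; d = e /
      (4 K) makes the final bound e.\<close>
    define K where "K = \<bar>L\<bar> + 1"
    have K: "K > 0" "L \<le> K" by (simp_all add: K_def)
    define d where "d = e / (4 * K)"
    have d: "d > 0" using e K by (simp add: d_def)
    obtain n where n: "real n * entropy_step n \<le> L" "spread b v (Suc n) \<le> d * real n"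
      using frequently_eventually_conj[OF slow sublinear_if_increments_vanish[OF inc d]]
      by (auto dest: frequently_ex)
    have "c \<le> 4 * entropy_step n * (d * real n)"
      by (rule order_trans[OF bound(1) mult_left_mono[OF n(2)]]) (use bound(2)[of n] in simp)
    also have "\<dots> = 4 * d * (real n * entropy_step n)" by simp
    also have "\<dots> \<le> 4 * d * K" using n(1) d K(2) by (intro mult_left_mono) auto
    also have "\<dots> = e" using K by (simp add: d_def)
    finally show ?thesis .
  qed
  then have "c \<le> 0" by (rule field_le_epsilon) simp
  moreover have "c = (q s)\<^sup>2 * ((norm v)\<^sup>2)\<^sup>2"
    by (simp add: c_def v_def cinner_self norm_power)
  ultimately have "(norm v)\<^sup>2 = 0" using q_pos[OF s] by (simp add: mult_le_0_iff)
  then show ?thesis by (simp add: v_def)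
qed

section \<open>Energy minimisation over coboundaries\<close>

definition coboundary :: "'h \<Rightarrow> 'g \<Rightarrow> 'h" where
  "coboundary \<xi> = (\<lambda>g\<in>carrier G. \<xi> - \<pi> g \<xi>)"

lemma coboundary_apply: "g \<in> carrier G \<Longrightarrow> coboundary \<xi> g = \<xi> - \<pi> g \<xi>"
  by (simp add: coboundary_def)

lemma coboundary_in: "coboundary \<xi> \<in> coboundaries G \<pi>"
  unfolding coboundaries_def cocycles_def
  by (auto simp: coboundary_def rep_mult rep_diff)

lemma coboundary_add: "g \<in> carrier G \<Longrightarrow> coboundary (\<xi> + \<eta>) g = coboundary \<xi> g + coboundary \<eta> g"
  by (simp add: coboundary_apply rep_add)

lemma coboundary_scaleR: "g \<in> carrier G \<Longrightarrow> coboundary (r *\<^sub>R \<xi>) g = r *\<^sub>R coboundary \<xi> g"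
  by (simp add: coboundary_apply rep_scaleR scaleR_diff_right)

text \<open>A squared Hilbert norm on the values at generators; these determine a cocycle
  (\<open>cocycle_zero_if_zero_on_S\<close>).\<close>

definition energy :: "('g \<Rightarrow> 'h) \<Rightarrow> real" where
  "energy f = (\<Sum>s\<in>S. q s * (norm (f s))\<^sup>2)"

lemma energy_nonneg: "0 \<le> energy f"
  unfolding energy_def by (intro sum_nonneg mult_nonneg_nonneg) (auto simp: q_pos less_imp_le)

lemma energy_member: "s \<in> S \<Longrightarrow> q s * (norm (f s))\<^sup>2 \<le> energy f"
  unfolding energy_def
  by (rule member_le_sum[of s S "\<lambda>s. q s * (norm (f s))\<^sup>2"]) (auto simp: finite_S q_pos less_imp_le)

lemma energy_cong: "(\<And>s. s \<in> S \<Longrightarrow> f s = g s) \<Longrightarrow> energy f = energy g"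
  unfolding energy_def by simp

lemma energy_parallelogram:
  "energy (\<lambda>s. f s - g s) + energy (\<lambda>s. f s + g s) = 2 * energy f + 2 * energy g"
  unfolding energy_def sum_distrib_left sum.distrib[symmetric]
  by (rule sum.cong) (simp_all add: norm_add_squared norm_diff_squared algebra_simps)

lemma energy_scaleR: "energy (\<lambda>s. r *\<^sub>R f s) = r\<^sup>2 * energy f"
  unfolding energy_def sum_distrib_left by (rule sum.cong) (simp_all add: power_mult_distrib)

lemma energy_diff_scaleR:
  "energy (\<lambda>s. f s - t *\<^sub>R g s) = energy f - 2 * t * (\<Sum>s\<in>S. q s * Re (cinner (f s) (g s))) + t\<^sup>2 * energy g"
  unfolding energy_def sum_distrib_left sum.distrib[symmetric] sum_subtractf[symmetric]
  by (rule sum.cong) (simp_all add: norm_diff_squared cinner_scaleR_right power_mult_distrib algebra_simps)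

text \<open>First variation of the energy in the direction h, the mean of b: by symmetry of
  \<open>q\<close> and b(s^-1) = - \<pi>_(s^-1) b(s) the derivative is a multiple of |h|^2.\<close>

lemma harmonic_if_energy_minimal:
  assumes b: "b \<in> cocycles G \<pi>" and min: "\<And>\<eta>. energy b \<le> energy (\<lambda>s. b s - coboundary \<eta> s)"
  shows "(\<Sum>s\<in>S. q s *\<^sub>R b s) = 0"
proof -
  define h where "h = (\<Sum>s\<in>S. q s *\<^sub>R b s)"
  define X where "X = (\<Sum>s\<in>S. q s * Re (cinner (b s) (coboundary h s)))"
  have "X = 2 * (norm h)\<^sup>2"
  proof -
    have "q s * Re (cinner (b s) (coboundary h s)) = Re (cinner (q s *\<^sub>R b s) h) + Re (cinner (q (inv s) *\<^sub>R b (inv s)) h)"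
      if s: "s \<in> S" for s
    proof -
      have "cinner (b (inv s)) h = - cinner (b s) (\<pi> s h)"
        using s by (simp add: cocycle_inv[OF b] cinner_minus_left cinner_rep_left)
      then show ?thesis
        using s by (simp add: coboundary_apply cinner_diff_right cinner_scaleR_left q_inv right_diff_distrib)
    qed
    then have "X = (\<Sum>s\<in>S. Re (cinner (q s *\<^sub>R b s) h)) + (\<Sum>s\<in>S. Re (cinner (q (inv s) *\<^sub>R b (inv s)) h))"
      by (simp add: X_def sum.distrib)
    also have "(\<Sum>s\<in>S. Re (cinner (q (inv s) *\<^sub>R b (inv s)) h)) = (\<Sum>s\<in>S. Re (cinner (q s *\<^sub>R b s) h))"
      by (rule sum_S_inv)
    also have "(\<Sum>s\<in>S. Re (cinner (q s *\<^sub>R b s) h)) = Re (cinner h h)"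
      unfolding Re_sum[symmetric] cinner.sum_left[symmetric] h_def[symmetric] ..
    finally show ?thesis by (simp add: Re_cinner_self)
  qed
  moreover have "X = 0"
  proof -
    define Y where "Y = energy (coboundary h)"
    have Y: "Y \<ge> 0" by (simp add: Y_def energy_nonneg)
    \<comment> \<open>The quadratic in t is minimal at X / Y; the shifted denominator cannot vanish
      and still forces t^2 (Y + 2) <= 0.\<close>
    define t where "t = X / (Y + 1)"
    have "energy b \<le> energy (\<lambda>s. b s - t *\<^sub>R coboundary h s)"
      using min[of "t *\<^sub>R h"] by (simp add: coboundary_scaleR cong: energy_cong)
    then have "0 \<le> - 2 * t * X + t\<^sup>2 * Y"
      unfolding energy_diff_scaleR X_def[symmetric] Y_def[symmetric] by simp
    also have "X = t * (Y + 1)" using Y by (simp add: t_def)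
    finally have "t\<^sup>2 * (Y + 2) \<le> 0" by (simp add: power2_eq_square algebra_simps)
    then have "t = 0" using Y by (simp add: mult_le_0_iff)
    then show ?thesis using Y by (simp add: t_def)
  qed
  ultimately show ?thesis by (simp add: h_def)
qed

text \<open>The cocycle identity and the isometry of \<pi> carry convergence from generators to
  products.\<close>

lemma convergent_on_group:
  assumes c: "\<And>n g h. g \<in> carrier G \<Longrightarrow> h \<in> carrier G \<Longrightarrow> c n (g \<otimes> h) = c n g + \<pi> g (c n h)"
    and S: "\<And>s. s \<in> S \<Longrightarrow> convergent (\<lambda>n. c n s)" and g: "g \<in> carrier G"
  shows "convergent (\<lambda>n. c n g)"
proof -
  have "g \<in> generate G S \<Longrightarrow> g \<in> carrier G \<and> convergent (\<lambda>n. c n g)" for g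
  proof (induction g rule: generate.induct)
    case one
    have "c n \<one> = 0" for n using c[of \<one> \<one> n] by simp
    then show ?case by (simp add: convergent_const)
  next
    case (eng h1 h2)
    then obtain l1 l2 where l: "(\<lambda>n. c n h1) \<longlonglongrightarrow> l1" "(\<lambda>n. c n h2) \<longlonglongrightarrow> l2"
      by (auto simp: convergent_def)
    have "(\<lambda>n. c n (h1 \<otimes> h2)) \<longlonglongrightarrow> l1 + \<pi> h1 l2"
      using tendsto_add[OF l(1) tendsto_rep[OF _ l(2)]] eng by (simp add: c)
    then show ?case using eng by (auto simp: convergent_def)
  qed (use S inv_S in auto)
  then show ?thesis using g gen_S by blast
qed

text \<open>A minimising sequence \<xi> n may run off to infinity, but the cocycles c - coboundary
  (\<xi> n) converge, and their limit is energy minimal, hence harmonic. Were it zero, the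
  coboundaries of \<xi> n would converge pointwise to c.\<close>

proposition harmonic_cocycle_exists:
  assumes c: "c \<in> cocycles G \<pi>" and nc: "c \<notin> approx_coboundaries G \<pi>"
  obtains b s where "harmonic_cocycle b" "s \<in> S" "b s \<noteq> 0"
proof -
  define \<phi> where "\<phi> \<xi> = energy (\<lambda>g. c g - coboundary \<xi> g)" for \<xi>
  define I where "I = Inf (range \<phi>)"
  have bdd: "bdd_below (range \<phi>)"
    by (rule bdd_belowI[of _ 0]) (auto simp: \<phi>_def energy_nonneg)
  have I: "I \<le> \<phi> \<xi>" for \<xi>
    unfolding I_def by (rule cInf_lower[OF _ bdd]) simp
  have "\<exists>\<xi>. \<phi> \<xi> < I + 1 / Suc n" for n
    using cInf_lessD[of "range \<phi>" "I + 1 / Suc n"] by (auto simp: I_def)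
  then obtain \<xi> where \<xi>: "\<And>n. \<phi> (\<xi> n) < I + 1 / Suc n" by metis
  define cn where "cn n g = c g - coboundary (\<xi> n) g" for n g
  have cn_mult: "cn n (g \<otimes> h) = cn n g + \<pi> g (cn n h)" if "g \<in> carrier G" "h \<in> carrier G" for n g h
    using that by (simp add: cn_def cocycle_mult[OF c] coboundary_apply rep_diff rep_mult)
  \<comment> \<open>Parallelogram law: the midpoint of \<xi> n and \<xi> m gives energy at least I,
    so the sum has energy at least 4 I, which leaves only the excesses over I.\<close>
  have dist: "q s * (norm (cn n s - cn m s))\<^sup>2 \<le> 2 / Suc n + 2 / Suc m" if s: "s \<in> S" for n m s
  proof -
    have "energy (\<lambda>s. cn n s + cn m s) = energy (\<lambda>s. 2 *\<^sub>R (c s - coboundary ((1/2) *\<^sub>R (\<xi> n + \<xi> m)) s))"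
      by (rule energy_cong) (simp add: cn_def coboundary_scaleR coboundary_add scaleR_diff_right scaleR_2)
    also have "\<dots> = 4 * \<phi> ((1/2) *\<^sub>R (\<xi> n + \<xi> m))"
      by (simp add: energy_scaleR \<phi>_def)
    finally have "4 * I \<le> energy (\<lambda>s. cn n s + cn m s)" using I by simp
    moreover have "energy (cn k) = \<phi> (\<xi> k)" for k by (simp add: \<phi>_def cn_def[abs_def])
    ultimately have "energy (\<lambda>s. cn n s - cn m s) \<le> 2 / Suc n + 2 / Suc m"
      using energy_parallelogram[of "cn n" "cn m"] \<xi>[of n] \<xi>[of m] by simp
    then show ?thesis using energy_member[OF s, of "\<lambda>s. cn n s - cn m s"] by linarith
  qed
  have conv: "convergent (\<lambda>n. cn n g)" if "g \<in> carrier G" for g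
  proof (rule convergent_on_group[OF cn_mult _ that])
    fix s assume s: "s \<in> S"
    show "convergent (\<lambda>n. cn n s)"
    proof (rule Cauchy_convergent, rule CauchyI)
      fix e :: real assume e: "e > 0"
      obtain M where M: "1 / Suc M < q s * e\<^sup>2 / 4"
        using reals_Archimedean[of "q s * e\<^sup>2 / 4"] e q_pos[OF s] by (auto simp: inverse_eq_divide)
      have "norm (cn m s - cn n s) < e" if "m \<ge> M" "n \<ge> M" for m n
      proof -
        have "1 / Suc m \<le> 1 / Suc M" "1 / Suc n \<le> 1 / Suc M"
          using that by (auto simp: field_simps)
        then have "q s * (norm (cn m s - cn n s))\<^sup>2 < q s * e\<^sup>2"
          using dist[OF s, of m n] M by simp
        then have "(norm (cn m s - cn n s))\<^sup>2 < e\<^sup>2" using q_pos[OF s] by simp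
        then show ?thesis using e by (simp add: power_less_imp_less_base)
      qed
      then show "\<exists>M. \<forall>m\<ge>M. \<forall>n\<ge>M. norm (cn m s - cn n s) < e" by blast
    qed
  qed
  define b where "b = (\<lambda>g\<in>carrier G. lim (\<lambda>n. cn n g))"
  have lim: "(\<lambda>n. cn n g) \<longlonglongrightarrow> b g" if "g \<in> carrier G" for g
    using conv[OF that] that by (simp add: b_def convergent_LIMSEQ_iff)
  have bc: "b \<in> cocycles G \<pi>"
  proof -
    have "b (g \<otimes> h) = b g + \<pi> g (b h)" if gh: "g \<in> carrier G" "h \<in> carrier G" for g h
    proof (rule LIMSEQ_unique[OF lim])
      show "(\<lambda>n. cn n (g \<otimes> h)) \<longlonglongrightarrow> b g + \<pi> g (b h)"
        using tendsto_add[OF lim[OF gh(1)] tendsto_rep[OF gh(1) lim[OF gh(2)]]] by (simp add: cn_mult gh)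
    qed (use gh in simp)
    then show ?thesis by (simp add: cocycles_def b_def)
  qed
  have "energy b \<le> I"
  proof (rule LIMSEQ_le)
    show "(\<lambda>n. energy (cn n)) \<longlonglongrightarrow> energy b"
      unfolding energy_def by (intro tendsto_intros lim S_carrier)
    show "(\<lambda>n. I + 1 / real (Suc n)) \<longlonglongrightarrow> I"
      using tendsto_add[OF tendsto_const[of I] LIMSEQ_Suc[OF lim_1_over_n]] by simp
    show "\<exists>N. \<forall>n\<ge>N. energy (cn n) \<le> I + 1 / real (Suc n)"
      using \<xi> by (auto simp: \<phi>_def cn_def[abs_def] intro: less_imp_le)
  qed
  moreover have "I \<le> energy (\<lambda>s. b s - coboundary \<eta> s)" for \<eta>
  proof (rule LIMSEQ_le_const)
    show "(\<lambda>n. energy (\<lambda>s. cn n s - coboundary \<eta> s)) \<longlonglongrightarrow> energy (\<lambda>s. b s - coboundary \<eta> s)"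
      unfolding energy_def by (intro tendsto_intros lim S_carrier)
    \<comment> \<open>Subtracting a further coboundary stays within the family over which I is the
      infimum.\<close>
    have "energy (\<lambda>s. cn n s - coboundary \<eta> s) = \<phi> (\<xi> n + \<eta>)" for n
      unfolding \<phi>_def by (rule energy_cong) (simp add: cn_def coboundary_add)
    then show "\<exists>N. \<forall>n\<ge>N. I \<le> energy (\<lambda>s. cn n s - coboundary \<eta> s)" using I by simp
  qed
  ultimately have "harmonic_cocycle b"
    unfolding harmonic_cocycle_def using harmonic_if_energy_minimal[OF bc] bc by (meson order_trans)
  moreover have "\<exists>s\<in>S. b s \<noteq> 0"
  proof (rule ccontr)
    assume "\<not> (\<exists>s\<in>S. b s \<noteq> 0)"
    then have b0: "b g = 0" if "g \<in> carrier G" for g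
      using cocycle_zero_if_zero_on_S[OF bc _ that] by blast
    have "limitin (product_topology (\<lambda>_. euclidean) (carrier G)) (\<lambda>n. coboundary (\<xi> n)) c sequentially"
      unfolding limitin_componentwise
    proof (intro conjI ballI)
      show "c \<in> extensional (carrier G)" using c by (simp add: cocycles_def)
      show "\<forall>\<^sub>F n in sequentially. coboundary (\<xi> n) \<in> topspace (product_topology (\<lambda>_. euclidean) (carrier G))"
        by (simp add: coboundary_def)
      fix g assume g: "g \<in> carrier G"
      have "(\<lambda>n. c g - cn n g) \<longlonglongrightarrow> c g - 0"
        using lim[OF g] b0[OF g] by (intro tendsto_intros) simp
      then show "limitin euclidean (\<lambda>n. coboundary (\<xi> n) g) (c g) sequentially"
        by (simp add: cn_def)
    qed
    then have "c \<in> product_topology (\<lambda>_. euclidean) (carrier G) closure_of coboundaries G \<pi>"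
    proof (rule limitin_closedin[OF _ closedin_closure_of])
      have "coboundaries G \<pi> \<subseteq> topspace (product_topology (\<lambda>_. euclidean) (carrier G))"
        by (auto simp: coboundaries_def cocycles_def extensional_def)
      then show "\<forall>\<^sub>F n in sequentially. coboundary (\<xi> n)
          \<in> product_topology (\<lambda>_. euclidean) (carrier G) closure_of coboundaries G \<pi>"
        using closure_of_subset coboundary_in by (intro always_eventually allI) blast
    qed simp
    then show False using c nc by (simp add: approx_coboundaries_def)
  qed
  ultimately show thesis using that by blast
qed

section \<open>The reduced cohomology as a quotient, and the conclusion\<close>

lemma cocycles_diff:
  assumes "b \<in> cocycles G \<pi>" "c \<in> cocycles G \<pi>"
  shows "(\<lambda>g\<in>carrier G. b g - c g) \<in> cocycles G \<pi>"
  using assms unfolding cocycles_def by (auto simp: rep_diff)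

lemma cocycles_add:
  assumes "b \<in> cocycles G \<pi>" "c \<in> cocycles G \<pi>"
  shows "(\<lambda>g\<in>carrier G. b g + c g) \<in> cocycles G \<pi>"
  using assms unfolding cocycles_def by (auto simp: rep_add)

text \<open>Used in contrapositive form, to extract a cocycle that is no limit of coboundaries. When
  the subgroup is everything, closure under sums and differences makes every coset the whole
  space.\<close>

lemma reduced_cohomology_trivial:
  assumes "cocycles G \<pi> \<subseteq> approx_coboundaries G \<pi>"
  shows "carrier (reduced_cohomology G \<pi>) = {\<one>\<^bsub>reduced_cohomology G \<pi>\<^esub>}"
proof -
  have eq: "approx_coboundaries G \<pi> = cocycles G \<pi>"
    using assms by (auto simp: approx_coboundaries_def)
  have "cocycles G \<pi> #>\<^bsub>cocycle_group G \<pi>\<^esub> a = cocycles G \<pi>" if a: "a \<in> cocycles G \<pi>" for a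
  proof (intro subset_antisym subsetI)
    fix x assume "x \<in> cocycles G \<pi> #>\<^bsub>cocycle_group G \<pi>\<^esub> a"
    then show "x \<in> cocycles G \<pi>"
      using cocycles_add[OF _ a] by (auto simp: r_coset_def cocycle_group_def)
  next
    fix x assume x: "x \<in> cocycles G \<pi>"
    define d where "d = (\<lambda>g\<in>carrier G. x g - a g)"
    have "x = (\<lambda>g\<in>carrier G. d g + a g)"
      using x by (intro extensionalityI[of _ "carrier G"]) (auto simp: cocycles_def d_def)
    moreover have "d \<in> cocycles G \<pi>"
      unfolding d_def by (rule cocycles_diff[OF x a])
    ultimately show "x \<in> cocycles G \<pi> #>\<^bsub>cocycle_group G \<pi>\<^esub> a"
      unfolding r_coset_def cocycle_group_def by auto
  qed
  moreover have "(\<lambda>g\<in>carrier G. 0) \<in> cocycles G \<pi>"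
    by (simp add: cocycles_def)
  ultimately show ?thesis
    unfolding reduced_cohomology_def FactGroup_def RCOSETS_def eq
    by (auto simp: cocycle_group_def)
qed

end

theorem mainTheorem1:
  fixes G :: "('g, 'm) monoid_scheme"
  assumes "group G"
    and "finitely_generated G"
    and "slow_entropy_growth G"
  shows "property_HFD TYPE('h :: chilbert_space) G"
  unfolding property_HFD_def
proof (intro allI impI notI)
  fix \<pi> :: "'g \<Rightarrow> 'h \<Rightarrow> 'h"
  assume rep: "unitary_rep G \<pi>" and wm: "weakly_mixing G \<pi>"
    and nz: "carrier (reduced_cohomology G \<pi>) \<noteq> {\<one>\<^bsub>reduced_cohomology G \<pi>\<^esub>}"
  obtain \<mu> where \<mu>: "set_pmf \<mu> \<subseteq> carrier G" "finite (set_pmf \<mu>)" "symmetric_measure G \<mu>"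
      "nondegenerate_measure G \<mu>" "pmf \<mu> \<one>\<^bsub>G\<^esub> > 0"
      "liminf (\<lambda>n. ereal (real n * (shannon_entropy G (conv_power G (pmf \<mu>) (n + 1))
                                    - shannon_entropy G (conv_power G (pmf \<mu>) n)))) < \<infinity>"
    using assms(3) by (auto simp: slow_entropy_growth_def)
  interpret group G by (rule assms)
  interpret walk_rep G "pmf \<mu>" "set_pmf \<mu>" \<pi>
  proof
    show "sum (pmf \<mu>) (set_pmf \<mu>) = 1" using \<mu>(2) by (intro sum_pmf_eq_1) auto
  qed (use \<mu> rep in \<open>auto simp: symmetric_measure_def nondegenerate_measure_def set_pmf_iff pmf_pos\<close>)
  \<comment> \<open>A liminf below infinity leaves some y < \<infinity> that bounds the sequence
    infinitely often.\<close>
  have "\<exists>y<\<infinity>. frequently (\<lambda>n. ereal (real n * entropy_step n) \<le> y) sequentially"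
    using \<mu>(6) le_Liminf_iff[of \<infinity> sequentially "\<lambda>n. ereal (real n * entropy_step n)"]
    by (auto simp: frequently_def not_le)
  then obtain y where y: "y < \<infinity>" "frequently (\<lambda>n. ereal (real n * entropy_step n) \<le> y) sequentially"
    by blast
  \<comment> \<open>\<open>y\<close> may be minus infinity, in which case any real \<open>L\<close>
    will do.\<close>
  obtain L where "y \<le> ereal L"
    using y(1) by (cases y) auto
  then have slow: "frequently (\<lambda>n. real n * entropy_step n \<le> L) sequentially"
    using frequently_elim1[OF y(2), of "\<lambda>n. real n * entropy_step n \<le> L"]
    by (metis ereal_less_eq(3) order_trans)
  obtain c where "c \<in> cocycles G \<pi>" "c \<notin> approx_coboundaries G \<pi>"
    using nz reduced_cohomology_trivial by blast
  then obtain b s where "harmonic_cocycle b" "s \<in> set_pmf \<mu>" "b s \<noteq> 0"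
    by (rule harmonic_cocycle_exists)
  then show False
    using harmonic_cocycle_zero[OF _ wm slow] by blast
qed

end
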